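(* Let $\beta>0$, let $L\ge1$ be an integer, let $\alpha\in(\alpha_{L+1},\alpha_L)$, and let $(X_n)_{n\ge0}$ be the self-interacting walk on $\mathbb{Z}$ with parameters $\alpha,\beta$ defined in the context, started from $X_0=0$. Let $\mathcal{L}$ be the random set of sites visited infinitely often by $(X_n)$. Define $\omega\in(0,\pi)$ by $\cos\omega=\frac{1-\alpha}{2\alpha}$, let $\varphi:=\frac12\bigl(2\pi-(L+2)\omega\bigr)$, and $$u_j:=\frac{\cos\varphi-\cos(\omega j+\varphi)}{Z},\qquad j=1,\dots,L+1,$$ where $Z$ is the normalising constant such that $u_1+\dots+u_{L+1}=1$. Then, for every $x\in\mathbb{Z}$, almost surely on the event $\{\mathcal{L}=\{x,x+1,\dots,x+L+1\}\}$, $$\lim_{n\to\infty}\frac1n\bigl(\ell(n,x+1),\dots,\ell(n,x+L+1)\bigr)=(u_1,\dots,u_{L+1}).$$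
   Context: For a nearest neighbour path $(X_n)_{n\ge0}$ on $\mathbb{Z}$ (i.e. $|X_{n+1}-X_n|=1$ for all $n$), the unoriented edge connecting $j-1$ and $j$ is denoted by $j$, and its local time is $$\ell(n,j):=\#\{1\le m\le n:\ \{X_{m-1},X_m\}=\{j-1,j\}\},\qquad n\ge 0,\ j\in\mathbb{Z}.$$ Given $\alpha\in\mathbb{R}$, set $$\Delta(n,j):=-\alpha\,\ell(n,j-1)+\ell(n,j)-\ell(n,j+1)+\alpha\,\ell(n,j+2),\qquad \Delta_n:=\Delta(n,X_n).$$ The walk with parameters $\alpha\in\mathbb{R}$, $\beta>0$ is the nearest neighbour random path with $X_0=0$ whose law is determined, with $\mathcal{F}_n=\sigma(X_0,\dots,X_n)$, by $$\mathbf{P}(X_{n+1}=X_n\pm1\mid\mathcal{F}_n)=\frac{e^{\pm\beta\Delta_n}}{e^{\beta\Delta_n}+e^{-\beta\Delta_n}},\qquad n\ge0.$$ The thresholds are $\alpha_1:=+\infty$ and, for $L\ge2$, $\alpha_L:=\dfrac{1}{1+2\cos(2\pi/(L+2))}$. The vector $(u_1,\dots,u_{L+1})$ is introduced in the paper as the unique solution $(l_1,\dots,l_{L+1})$ of the linear system $-\alpha l_{j-1}+l_j-l_{j+1}+\alpha l_{j+2}=0$ for $j=1,\dots,L$, and $l_1+\dots+l_{L+1}=1$, with the convention $l_0=l_{L+2}=0$. *)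

theory Defs
  imports "HOL-Probability.Probability"
begin

text \<open>Deterministic functionals of a path \<open>p :: nat \<Rightarrow> int\<close>.
  The unoriented edge between \<open>j - 1\<close> and \<open>j\<close> is denoted by \<open>j\<close>.\<close>

definition local_time :: "(nat \<Rightarrow> int) \<Rightarrow> nat \<Rightarrow> int \<Rightarrow> nat" where
  "local_time p n j = card {m. 1 \<le> m \<and> m \<le> n \<and> {p (m - 1), p m} = {j - 1, j}}"

definition Delta :: "real \<Rightarrow> (nat \<Rightarrow> int) \<Rightarrow> nat \<Rightarrow> int \<Rightarrow> real" where
  "Delta \<alpha> p n j =
     - \<alpha> * real (local_time p n (j - 1)) + real (local_time p n j)
     - real (local_time p n (j + 1)) + \<alpha> * real (local_time p n (j + 2))"

definition visited_infinitely_often :: "(nat \<Rightarrow> int) \<Rightarrow> int set" where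
  "visited_infinitely_often p = {y. infinite {n. p n = y}}"

definition path_filtration :: "'a measure \<Rightarrow> (nat \<Rightarrow> 'a \<Rightarrow> int) \<Rightarrow> nat \<Rightarrow> 'a measure" where
  "path_filtration M X n = sigma (space M) {X i -` A \<inter> space M | i A. i \<le> n}"

text \<open>A realisation of the walk on an arbitrary probability space. Conditional probabilities
  given \<open>\<sigma>(X 0, \<dots>, X n)\<close> are conditional expectations of indicators.\<close>

locale self_interacting_walk = prob_space M
  for M :: "'a measure" +
  fixes \<alpha> \<beta> :: real and X :: "nat \<Rightarrow> 'a \<Rightarrow> int"
  assumes random_variable_X: "\<And>n. random_variable (count_space UNIV) (X n)"
    and start: "AE \<xi> in M. X 0 \<xi> = 0"
    and nearest_neighbour: "AE \<xi> in M. \<forall>n. \<bar>X (Suc n) \<xi> - X n \<xi>\<bar> = 1"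
    and step_right: "\<And>n. AE \<xi> in M.
      real_cond_exp M (path_filtration M X n)
        (indicator {\<eta> \<in> space M. X (Suc n) \<eta> = X n \<eta> + 1}) \<xi>
      = (let D = Delta \<alpha> (\<lambda>k. X k \<xi>) n (X n \<xi>)
         in exp (\<beta> * D) / (exp (\<beta> * D) + exp (- \<beta> * D)))"
    and step_left: "\<And>n. AE \<xi> in M.
      real_cond_exp M (path_filtration M X n)
        (indicator {\<eta> \<in> space M. X (Suc n) \<eta> = X n \<eta> - 1}) \<xi>
      = (let D = Delta \<alpha> (\<lambda>k. X k \<xi>) n (X n \<xi>)
         in exp (- \<beta> * D) / (exp (\<beta> * D) + exp (- \<beta> * D)))"
begin

text \<open>\<^const>\<open>real_cond_exp\<close> is only meaningful for sub-\<open>\<sigma>\<close>-algebras.\<close>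

lemma subalgebra_path_filtration: "subalgebra M (path_filtration M X n)"
proof -
  have "X i -` A \<inter> space M \<in> sets M" for i A
    using measurable_sets[OF random_variable_X, of A i] by simp
  then have "{X i -` A \<inter> space M | i A. i \<le> n} \<subseteq> sets M"
    by blast
  moreover have "{X i -` A \<inter> space M | i A. i \<le> n} \<subseteq> Pow (space M)"
    by blast
  ultimately show ?thesis
    unfolding subalgebra_def path_filtration_def
    by (simp add: sets.sigma_sets_subset)
qed

end

definition threshold :: "nat \<Rightarrow> ereal" where
  "threshold L = (if L = 1 then \<infinity> else ereal (1 / (1 + 2 * cos (2 * pi / real (L + 2)))))"

end

theory Submission
  imports Defs "HOL-Real_Asymp.Real_Asymp"
begin

text \<open>
  Put \<open>V\<^sub>j = (1 - \<alpha>) l\<^sub>j - \<alpha> (l\<^sub>j\<^sub>-\<^sub>1 + l\<^sub>j\<^sub>+\<^sub>1)\<close> for the local times \<open>l\<close>. Then the bias at a site is the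
  difference \<open>\<Delta>\<^sub>j = V\<^sub>j - V\<^sub>j\<^sub>+\<^sub>1\<close> of the potentials of its two edges, and the walk prefers the edge of
  lower potential. By Borel-Cantelli, almost surely every late step at which \<open>\<bar>\<Delta>\<bar>\<close> exceeds a multiple
  of the logarithm of the time goes to the lower edge (\<open>eventually_repelled\<close>). This is the only use
  of probability; all that follows holds for every single path that obeys this rule.

  Consider a path on an interval of \<open>k\<close> edges, with \<open>(k + 1) \<omega> < 2 \<pi>\<close>, that obeys the rule with a
  fixed threshold \<open>S\<close> and starts with all inner \<open>\<bar>\<Delta>\<^sub>j\<bar>\<close> at most \<open>S\<close>. The heart of the proof is that
  these differences then stay below \<open>C S\<close> for ever, with \<open>C\<close> independent of the path
  (\<open>stable k\<close>). Given this, linear algebra (\<open>kernel_bound\<close>) shows that the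
  increments of the local times over a time \<open>t\<close> are \<open>t\<close> times the normalised solution of
  \<open>\<Delta> = 0\<close>, up to an error of order \<open>S\<close> (\<open>balanced\<close>). On the event in question the walk
  is eventually confined to \<open>L + 1\<close> edges, and \<open>\<alpha> < \<alpha>\<^sub>L\<close> means \<open>(L + 2) \<omega> < 2 \<pi>\<close>; starting at time
  \<open>\<surd>n\<close> with a threshold of order \<open>\<surd>n\<close> gives the limit (\<open>local_time_asymptotics\<close>).

  Stability is proved by induction on \<open>k\<close>. As long as the walk avoids one end of an interval of
  \<open>k + 1\<close> edges, it sees only \<open>k\<close> edges, on which the local times grow in
  proportion to the solution for \<open>k\<close> edges. The explicit trigonometric form of that solution
  (\<open>profile_drift\<close>) shows that the potential of the missing edge then drops linearly relative to
  its neighbour, so that the end is reached after a time proportional to the current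
  differences (\<open>exit_time\<close>). Hence the walk keeps crossing the whole interval in both directions.
  A crossing from left to right leaves a potential that is nearly nonincreasing, because after the
  last visit to a site the lower edge to its right only gets lower (\<open>rightmost_gaps\<close>).
  During the way back the walk absorbs the edges one at a time, each being entered at
  the moment at which its potential has come down to the level of the edges already absorbed. So on
  arrival all differences are of order \<open>S\<close>, whatever they were before
  (\<open>sweeping\<close>). Such times therefore recur with gaps of order \<open>S\<close>, which bounds the
  differences at all times (\<open>stable_Suc\<close>).
\<close>

section \<open>The linear system on an interval\<close>

locale walk_params =
  fixes \<alpha> \<omega> :: real
  assumes alpha_pos: "\<alpha> > 0"
    and omega_pos: "0 < \<omega>" and omega_less: "\<omega> < pi"
    and cos_omega: "cos \<omega> = (1 - \<alpha>) / (2 * \<alpha>)"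
begin

lemma two_alpha_cos: "2 * \<alpha> * cos \<omega> = 1 - \<alpha>"
  using alpha_pos cos_omega by (simp add: field_simps)

lemma sin_omega_pos: "sin \<omega> > 0"
  using omega_pos omega_less by (rule sin_gt_zero)

text \<open>With \<open>\<phi> = \<pi> - (k + 1) \<omega> / 2\<close> this is \<open>cos \<phi> - cos (\<omega> i + \<phi>)\<close>; the form below shows the
  symmetry about the middle of the interval, which makes positivity and the
  vanishing at \<open>0\<close> and \<open>k + 1\<close> evident.\<close>

definition profile :: "nat \<Rightarrow> nat \<Rightarrow> real" where
  "profile k i = cos (\<omega> * real i - \<omega> * real (k + 1) / 2) - cos (\<omega> * real (k + 1) / 2)"

definition weight :: "nat \<Rightarrow> nat \<Rightarrow> real" where
  "weight k i = profile k i / (\<Sum>j=1..k. profile k j)"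

lemma profile_0 [simp]: "profile k 0 = 0"
  by (simp add: profile_def)

lemma profile_end [simp]: "profile k (Suc k) = 0"
proof -
  have "\<omega> * real (Suc k) - \<omega> * real (k + 1) / 2 = \<omega> * real (k + 1) / 2"
    by simp
  then show ?thesis unfolding profile_def by simp
qed

lemma profile_pos:
  assumes "1 \<le> i" "i \<le> k" and small: "real (k + 1) * \<omega> < 2 * pi"
  shows "profile k i > 0"
proof -
  define c where "c = \<omega> * real (k + 1) / 2"
  have "\<omega> * real i > 0" "\<omega> * real i < 2 * c"
    using assms omega_pos by (auto simp: c_def)
  then have "\<bar>\<omega> * real i - c\<bar> < c" by linarith
  moreover have "c \<le> pi" using small by (simp add: c_def mult.commute)
  ultimately have "cos c < cos \<bar>\<omega> * real i - c\<bar>"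
    by (intro cos_monotone_0_pi) auto
  then show ?thesis
    by (simp add: profile_def c_def)
qed

lemma profile_sum_pos:
  assumes "1 \<le> k" "real (k + 1) * \<omega> < 2 * pi"
  shows "(\<Sum>j=1..k. profile k j) > 0"
  using assms by (intro sum_pos) (auto intro: profile_pos)

lemma weight_pos:
  assumes "1 \<le> i" "i \<le> k" "real (k + 1) * \<omega> < 2 * pi"
  shows "weight k i > 0"
  using assms unfolding weight_def by (intro divide_pos_pos profile_pos profile_sum_pos) auto

lemma weight_ends [simp]: "weight k 0 = 0" "weight k (Suc k) = 0"
  by (simp_all add: weight_def)

lemma weight_sum:
  assumes "1 \<le> k" "real (k + 1) * \<omega> < 2 * pi"
  shows "(\<Sum>j=1..k. weight k j) = 1"
  using profile_sum_pos[OF assms] by (simp add: weight_def flip: sum_divide_distrib)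

lemma cos_recurrence: "cos (x + 2 * \<omega>) + cos x = 2 * cos \<omega> * cos (x + \<omega>)"
proof -
  have "cos (y + \<omega>) + cos (y - \<omega>) = 2 * cos \<omega> * cos y" for y
    by (simp add: cos_add cos_diff)
  from this[of "x + \<omega>"] show ?thesis by (simp add: algebra_simps)
qed

lemma alpha_cos_recurrence:
  "\<alpha> * (cos (x + 2 * \<omega>) + cos x) = (1 - \<alpha>) * cos (x + \<omega>)"
  unfolding cos_recurrence two_alpha_cos[symmetric] by simp

text \<open>The profile consists of a constant and a multiple of the frequency \<open>\<omega>\<close>; the latter is killed by
  \<open>l \<mapsto> (1 - \<alpha>) l\<^sub>i - \<alpha> (l\<^sub>i\<^sub>-\<^sub>1 + l\<^sub>i\<^sub>+\<^sub>1)\<close> because of the choice of \<open>\<omega>\<close>. So the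
  potential of the profile is constant, i.e. the bias vanishes at every inner site.\<close>

lemma profile_potential:
  "(1 - \<alpha>) * profile k (i + 1) - \<alpha> * (profile k i + profile k (i + 2))
     = (3 * \<alpha> - 1) * cos (\<omega> * real (k + 1) / 2)"
proof -
  define x where "x = \<omega> * real i - \<omega> * real (k + 1) / 2"
  have eq: "\<omega> * real (i + 2) - \<omega> * real (k + 1) / 2 = x + 2 * \<omega>"
    "\<omega> * real (i + 1) - \<omega> * real (k + 1) / 2 = x + \<omega>"
    by (simp_all add: x_def algebra_simps)
  show ?thesis
    unfolding profile_def eq x_def[symmetric] using alpha_cos_recurrence[of x] by (simp add: algebra_simps)
qed

text \<open>This is the rate at which the bias at the left end site moves when the edges of the interval are used in
  proportion to the profile. Continuing the sinusoid to the index \<open>-1\<close>, it equals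
  \<open>\<alpha> (cos (c + \<omega>) - cos c)\<close> with \<open>c = (k + 1) \<omega> / 2\<close>, which is negative exactly as long as
  one more edge still fits.\<close>

lemma profile_drift:
  assumes small: "real (k + 2) * \<omega> < 2 * pi"
  shows "\<alpha> * profile k 2 - profile k 1 < 0"
proof -
  define c where "c = \<omega> * real (k + 1) / 2"
  have "\<alpha> * cos (\<omega> * 2 - c) = (1 - \<alpha>) * cos (\<omega> - c) - \<alpha> * cos c"
    using alpha_cos_recurrence[of "- c"] by (simp add: algebra_simps)
  moreover have "\<alpha> * (cos (\<omega> - c) + cos (c + \<omega>)) = (1 - \<alpha>) * cos c"
    using alpha_cos_recurrence[of "c - \<omega>"] cos_minus[of "c - \<omega>"] by (simp add: algebra_simps)
  ultimately have "\<alpha> * profile k 2 - profile k 1 = \<alpha> * (cos (c + \<omega>) - cos c)"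
    by (simp add: profile_def flip: c_def) (simp add: algebra_simps c_def)
  also have "cos (c + \<omega>) - cos c < 0"
  proof -
    have "cos (c + \<omega>) - cos c = - (2 * sin (c + \<omega> / 2) * sin (\<omega> / 2))"
      using cos_diff_cos[of "c + \<omega>" c] sin_minus[of "\<omega> / 2"]
      by (simp add: add_divide_distrib)
    moreover have "sin (\<omega> / 2) > 0" using omega_pos omega_less by (intro sin_gt_zero) auto
    moreover have "sin (c + \<omega> / 2) > 0"
      using small omega_pos by (intro sin_gt_zero) (auto simp: c_def algebra_simps add_divide_distrib add_pos_nonneg)
    ultimately show ?thesis by simp
  qed
  then have "\<alpha> * (cos (c + \<omega>) - cos c) < 0" using alpha_pos by (simp add: mult_pos_neg)
  finally show ?thesis .
qed

lemma sum_sin_pos: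
  assumes "1 \<le> k" "real (k + 1) * \<omega> < 2 * pi"
  shows "(\<Sum>i=1..k. sin (\<omega> * real i)) > 0"
proof -
  have *: "sin (\<omega> / 2) * (\<Sum>i=1..n. sin (\<omega> * real i)) = sin (real (n + 1) * \<omega> / 2) * sin (real n * \<omega> / 2)" for n
  proof (induction n)
    case (Suc n)
    define y where "y = real (n + 1) * \<omega> / 2"
    have e: "\<omega> * real (Suc n) = 2 * y" "real (Suc n + 1) * \<omega> / 2 = y + \<omega> / 2"
      "real n * \<omega> / 2 = y - \<omega> / 2" "real (Suc n) * \<omega> / 2 = y"
      by (simp_all add: y_def field_simps)
    have "sin (\<omega> / 2) * (\<Sum>i=1..Suc n. sin (\<omega> * real i))
        = sin (\<omega> / 2) * (\<Sum>i=1..n. sin (\<omega> * real i)) + sin (\<omega> / 2) * sin (\<omega> * real (Suc n))"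
      by (simp add: distrib_left)
    also have "\<dots> = sin y * sin (y - \<omega> / 2) + sin (\<omega> / 2) * sin (2 * y)"
      unfolding Suc.IH e y_def[symmetric] ..
    also have "\<dots> = sin (y + \<omega> / 2) * sin y"
      by (simp only: sin_double) (simp add: sin_add sin_diff algebra_simps)
    finally show ?case unfolding e .
  qed simp
  have "sin (\<omega> / 2) > 0" using omega_pos omega_less by (intro sin_gt_zero) auto
  moreover have "sin (real (k + 1) * \<omega> / 2) > 0"
    using assms omega_pos by (intro sin_gt_zero) auto
  moreover have "sin (real k * \<omega> / 2) > 0"
    using assms omega_pos by (intro sin_gt_zero) (auto simp: algebra_simps)
  ultimately show ?thesis
    using *[of k] by (metis mult_pos_pos zero_less_mult_pos)
qed

text \<open>Quantitative uniqueness for the linear system. Small biases mean that the potential \<open>V\<close> of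
  \<open>d\<close> is nearly constant. Summation by parts against the profile, whose potential is constant,
  and \<open>\<Sum> d = 0\<close> show that this constant is small too. Then \<open>d\<close> nearly solves the homogeneous
  second order recurrence with \<open>d 0 = 0\<close>, so it is close to a multiple of \<open>sin (\<omega> i)\<close>, and
  the multiple is small because \<open>\<Sum> d = 0\<close> while \<open>\<Sum> sin (\<omega> i) > 0\<close>.\<close>

lemma kernel_bound:
  assumes k: "1 \<le> k" and small: "real (k + 1) * \<omega> < 2 * pi"
  shows "\<exists>C\<ge>0. \<forall>d G. d 0 = 0 \<longrightarrow> d (k + 1) = 0 \<longrightarrow> (\<Sum>i=1..k. d i) = 0 \<longrightarrow>
     (\<forall>i. i + 3 \<le> k + 1 \<longrightarrow> \<bar>- \<alpha> * d i + d (i + 1) - d (i + 2) + \<alpha> * d (i + 3)\<bar> \<le> G) \<longrightarrow> 0 \<le> G \<longrightarrow>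
     (\<forall>i\<in>{1..k}. \<bar>d i\<bar> \<le> C * G)"
proof -
  define \<Sigma> where "\<Sigma> = (\<Sum>i=1..k. sin (\<omega> * real i))"
  have Spos: "\<Sigma> > 0" using sum_sin_pos[OF assms] by (simp add: \<Sigma>_def)
  define E where "E = 2 * real k / \<alpha> * 4 ^ k"
  have E0: "E \<ge> 0" using alpha_pos by (simp add: E_def)
  define C where "C = real k * E / \<Sigma> + E"
  show ?thesis
  proof (intro exI[of _ C] conjI allI impI ballI)
    show "C \<ge> 0" using Spos E0 by (simp add: C_def)
    fix d :: "nat \<Rightarrow> real" and G i
    assume d0: "d 0 = 0" and dk: "d (k + 1) = 0" and dsum: "(\<Sum>i=1..k. d i) = 0"
      and gap: "\<forall>i. i + 3 \<le> k + 1 \<longrightarrow> \<bar>- \<alpha> * d i + d (i + 1) - d (i + 2) + \<alpha> * d (i + 3)\<bar> \<le> G"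
      and G0: "0 \<le> G" and i: "i \<in> {1..k}"
    define V where "V i = (1 - \<alpha>) * d (i + 1) - \<alpha> * (d i + d (i + 2))" for i
    have Vstep: "\<bar>V (i + 1) - V i\<bar> \<le> G" if "i + 3 \<le> k + 1" for i
      using gap[rule_format, OF that] by (simp add: V_def algebra_simps numeral_eq_Suc)
    have Vnear: "\<bar>V i - V 0\<bar> \<le> real i * G" if "i < k" for i
      using that
    proof (induction i)
      case (Suc i)
      then show ?case using Vstep[of i] by (simp add: algebra_simps)
    qed simp
    have Vnear': "\<bar>V i - V 0\<bar> \<le> real k * G" if "i < k" for i
      using Vnear[OF that] mult_right_mono[of "real i" "real k" G] that G0 by linarith
    let ?w = "profile k"
    let ?c = "(3 * \<alpha> - 1) * cos (\<omega> * real (k + 1) / 2)"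
    \<comment> \<open>Summation by parts: the boundary term vanishes at \<open>k\<close> since both \<open>d\<close> and the profile do at \<open>k + 1\<close>.\<close>
    have tele: "(\<Sum>j<n. ?w (j + 1) * V j - ?c * d (j + 1)) = \<alpha> * (?w (n + 1) * d n - ?w n * d (n + 1))" for n
    proof (induction n)
      case (Suc n)
      then show ?case
        unfolding sum.lessThan_Suc Suc profile_potential[of k n, symmetric] V_def
        by (simp add: algebra_simps numeral_eq_Suc)
    qed (simp add: d0)
    have sh: "(\<Sum>j<k. f (j + 1)) = (\<Sum>j=1..k. f j)" for f :: "nat \<Rightarrow> real"
      by (rule sum.reindex_bij_witness[of _ "\<lambda>j. j - 1" "\<lambda>j. j + 1"]) auto
    have "(\<Sum>j<k. ?w (j + 1) * V j) = 0"
      using tele[of k] dk dsum sh[of d] by (simp add: sum_subtractf flip: sum_distrib_left)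
    then have "V 0 * (\<Sum>j<k. ?w (j + 1)) = - (\<Sum>j<k. ?w (j + 1) * (V j - V 0))"
      by (simp add: algebra_simps sum_subtractf flip: sum_distrib_left)
    then have "\<bar>V 0\<bar> * \<bar>\<Sum>j<k. ?w (j + 1)\<bar> \<le> \<bar>\<Sum>j<k. ?w (j + 1) * (V j - V 0)\<bar>"
      by (metis abs_minus_cancel abs_mult order_refl)
    also have "\<dots> \<le> (\<Sum>j<k. ?w (j + 1) * (real k * G))"
    proof (rule order_trans[OF sum_abs], intro sum_mono)
      fix j assume "j \<in> {..<k}"
      then show "\<bar>?w (j + 1) * (V j - V 0)\<bar> \<le> ?w (j + 1) * (real k * G)"
        using profile_pos[of "j + 1" k] small Vnear'[of j]
        by (auto simp: abs_mult intro!: mult_mono)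
    qed
    also have "\<dots> = real k * G * (\<Sum>j<k. ?w (j + 1))"
      by (simp add: sum_distrib_left algebra_simps)
    finally have "\<bar>V 0\<bar> * (\<Sum>j<k. ?w (j + 1)) \<le> real k * G * (\<Sum>j<k. ?w (j + 1))"
      using profile_sum_pos[OF assms] sh[of "?w"] by simp
    then have V0: "\<bar>V 0\<bar> \<le> real k * G"
      using profile_sum_pos[OF assms] sh[of "?w"] by simp
    have Vb: "\<bar>V i\<bar> \<le> 2 * real k * G" if "i < k" for i
      using V0 Vnear'[OF that] by linarith
    define q where "q = d 1 / sin \<omega>"
    define e where "e i = d i - q * sin (\<omega> * real i)" for i
    have e0: "e 0 = 0" "e 1 = 0" using sin_omega_pos by (simp_all add: e_def d0 q_def)
    have srec: "sin (\<omega> * real (i + 2)) = 2 * cos \<omega> * sin (\<omega> * real (i + 1)) - sin (\<omega> * real i)" for i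
    proof -
      have "sin (y + \<omega>) + sin (y - \<omega>) = 2 * cos \<omega> * sin y" for y
        by (simp add: sin_add sin_diff)
      from this[of "\<omega> * real (i + 1)"] show ?thesis by (simp add: algebra_simps)
    qed
    define H where "H = 2 * real k * G / \<alpha>"
    have H0: "H \<ge> 0" using alpha_pos G0 by (simp add: H_def)
    have erec: "\<bar>e (i + 2)\<bar> \<le> 2 * \<bar>e (i + 1)\<bar> + \<bar>e i\<bar> + H" if "i < k" for i
    proof -
      have "\<alpha> * d (i + 2) = (2 * \<alpha> * cos \<omega>) * d (i + 1) - \<alpha> * d i - V i"
        by (simp only: two_alpha_cos V_def) (simp add: algebra_simps)
      then have "d (i + 2) = 2 * cos \<omega> * d (i + 1) - d i - V i / \<alpha>"
        using alpha_pos by (simp add: field_simps)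
      then have "e (i + 2) = 2 * cos \<omega> * e (i + 1) - e i - V i / \<alpha>"
        unfolding e_def srec by (simp add: algebra_simps)
      moreover have "\<bar>2 * cos \<omega> * e (i + 1)\<bar> \<le> 2 * \<bar>e (i + 1)\<bar>"
        using abs_cos_le_one[of \<omega>] mult_right_mono[of "\<bar>cos \<omega>\<bar>" 1 "\<bar>e (i + 1)\<bar>"] by (simp add: abs_mult)
      moreover have "\<bar>V i / \<alpha>\<bar> \<le> H"
        using Vb[OF that] alpha_pos by (simp add: H_def divide_right_mono)
      ultimately show ?thesis by linarith
    qed
    \<comment> \<open>Any growth rate \<open>q\<close> with \<open>q\<^sup>2 \<ge> 2 q + 2\<close> would do.\<close>
    have eb: "i \<le> k \<longrightarrow> \<bar>e i\<bar> \<le> H * 4 ^ i" for i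
    proof (induction i rule: induct_nat_012)
      case (ge2 n)
      have "H * 1 \<le> H * 4 ^ n" using H0 by (intro mult_left_mono) auto
      then show ?case using ge2 erec[of n] H0 by (auto simp: numeral_eq_Suc)
    qed (use e0 H0 in auto)
    have eb': "\<bar>e i\<bar> \<le> E * G" if "i \<le> k" for i
    proof -
      have "H * 4 ^ i \<le> H * 4 ^ k" using H0 that by (intro mult_left_mono power_increasing) auto
      also have "\<dots> = E * G" by (simp add: H_def E_def)
      finally show ?thesis using eb[of i] that by simp
    qed
    have "0 = (\<Sum>i=1..k. q * sin (\<omega> * real i) + e i)"
      using dsum by (simp add: e_def)
    also have "\<dots> = q * \<Sigma> + (\<Sum>i=1..k. e i)"
      by (simp add: \<Sigma>_def sum.distrib sum_distrib_left)
    finally have "\<bar>q * \<Sigma>\<bar> \<le> \<bar>\<Sum>i=1..k. e i\<bar>" by linarith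
    also have "\<dots> \<le> (\<Sum>i=1..k. E * G)"
      by (rule order_trans[OF sum_abs], intro sum_mono) (use eb' in auto)
    finally have "\<bar>q\<bar> * \<Sigma> \<le> real k * E * G" using Spos by (simp add: abs_mult)
    then have q: "\<bar>q\<bar> \<le> real k * E * G / \<Sigma>" using Spos by (simp add: field_simps)
    have "\<bar>d i\<bar> = \<bar>q * sin (\<omega> * real i) + e i\<bar>" by (simp add: e_def)
    also have "\<dots> \<le> \<bar>q\<bar> * \<bar>sin (\<omega> * real i)\<bar> + \<bar>e i\<bar>"
      by (metis abs_mult abs_triangle_ineq)
    also have "\<dots> \<le> \<bar>q\<bar> * 1 + E * G"
      using i by (intro add_mono mult_left_mono eb') auto
    also have "\<dots> \<le> C * G" using q by (simp add: C_def algebra_simps)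
    finally show "\<bar>d i\<bar> \<le> C * G" .
  qed
qed

end

section \<open>Paths, local times and the drift rule\<close>

lemma local_time_0 [simp]: "local_time p 0 j = 0"
  by (simp add: local_time_def)

lemma card_Suc_interval:
  "card {m. 1 \<le> m \<and> m \<le> Suc n \<and> P m} = card {m. 1 \<le> m \<and> m \<le> n \<and> P m} + (if P (Suc n) then 1 else 0)"
proof -
  have fin: "finite {m. 1 \<le> m \<and> m \<le> n \<and> P m}"
    by (rule finite_subset[of _ "{..n}"]) auto
  have "{m. 1 \<le> m \<and> m \<le> Suc n \<and> P m}
      = (if P (Suc n) then insert (Suc n) {m. 1 \<le> m \<and> m \<le> n \<and> P m} else {m. 1 \<le> m \<and> m \<le> n \<and> P m})"
    by (auto simp: le_Suc_eq)
  then show ?thesis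
    using fin by simp
qed

definition crosses :: "(nat \<Rightarrow> int) \<Rightarrow> nat \<Rightarrow> int \<Rightarrow> bool" where
  "crosses p n j \<longleftrightarrow> {p n, p (Suc n)} = {j - 1, j}"

lemma crosses_iff:
  "crosses p n j \<longleftrightarrow> p n = j - 1 \<and> p (Suc n) = j \<or> p n = j \<and> p (Suc n) = j - 1"
  unfolding crosses_def doubleton_eq_iff ..

lemma local_time_Suc:
  "local_time p (Suc n) j = local_time p n j + (if crosses p n j then 1 else 0)"
  unfolding local_time_def card_Suc_interval crosses_def by simp

text \<open>Reflection exchanges the roles of the two ends of an interval, so that statements are proved
  for one end only. The edge \<open>j\<close> joins \<open>j - 1\<close> and \<open>j\<close>, hence its mirror image is the edge \<open>1 - j\<close>.\<close>

lemma local_time_mirror: "local_time (\<lambda>n. - p n) n j = local_time p n (1 - j)"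
proof -
  have "({- a, - b} = {j - 1, j}) = ({a, b} = {1 - j - 1, 1 - j})" for a b :: int
    by (auto simp: doubleton_eq_iff)
  then show ?thesis by (simp add: local_time_def)
qed

lemma Delta_mirror: "Delta \<alpha> (\<lambda>n. - p n) n j = - Delta \<alpha> p n (- j)"
  by (simp add: Delta_def local_time_mirror algebra_simps minus_diff_commute)

definition crossings :: "(nat \<Rightarrow> int) \<Rightarrow> nat \<Rightarrow> nat \<Rightarrow> int \<Rightarrow> real" where
  "crossings p s n j = real (local_time p n j) - real (local_time p s j)"

lemma crossings_self [simp]: "crossings p s s j = 0"
  by (simp add: crossings_def)

lemma crossings_Suc:
  "crossings p s (Suc n) j = crossings p s n j + (if crosses p n j then 1 else 0)"
  by (simp add: crossings_def local_time_Suc)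

lemma crossings_bounds:
  assumes "s \<le> n"
  shows "0 \<le> crossings p s n j \<and> crossings p s n j \<le> real n - real s"
  using assms by (induction n rule: dec_induct) (auto simp: crossings_Suc)

lemma crossings_eq_0:
  assumes "s \<le> n" "\<And>m. s \<le> m \<Longrightarrow> m < n \<Longrightarrow> \<not> crosses p m j"
  shows "crossings p s n j = 0"
  using assms by (induction n rule: dec_induct) (auto simp: crossings_Suc)

lemma sum_crossings:
  assumes "s \<le> n"
    and "\<And>m. s \<le> m \<Longrightarrow> m < n \<Longrightarrow> \<bar>p (Suc m) - p m\<bar> = 1"
    and "\<And>m. s \<le> m \<Longrightarrow> m \<le> n \<Longrightarrow> a \<le> p m \<and> p m \<le> a + int k"
  shows "(\<Sum>i=1..k. crossings p s n (a + int i)) = real n - real s"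
  using assms
proof (induction n rule: dec_induct)
  case (step n)
  define i0 where "i0 = nat (max (p n) (p (Suc n)) - a)"
  have st: "\<bar>p (Suc n) - p n\<bar> = 1" and c: "a \<le> p n" "p n \<le> a + int k" "a \<le> p (Suc n)" "p (Suc n) \<le> a + int k"
    using step by auto
  have i0: "i0 \<in> {1..k}" and e: "a + int i0 = max (p n) (p (Suc n))"
    using st c by (auto simp: i0_def)
  have *: "crosses p n (a + int i) = (i = i0)" for i
    using st e by (auto simp: crosses_iff max_def split: if_splits)
  have "(\<Sum>i=1..k. crossings p s (Suc n) (a + int i))
      = (\<Sum>i=1..k. crossings p s n (a + int i)) + (\<Sum>i=1..k. if i = i0 then 1 else 0)"
    by (simp add: crossings_Suc * sum.distrib)
  also have "\<dots> = real n - real s + 1" using step i0 by simp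
  finally show ?case by simp
qed simp

lemma Delta_diff:
  "Delta \<alpha> p n j - Delta \<alpha> p s j =
     - \<alpha> * crossings p s n (j - 1) + crossings p s n j - crossings p s n (j + 1) + \<alpha> * crossings p s n (j + 2)"
  by (simp add: Delta_def crossings_def algebra_simps)

lemma Delta_lipschitz:
  assumes "\<alpha> \<ge> 0" "s \<le> n"
  shows "\<bar>Delta \<alpha> p n j - Delta \<alpha> p s j\<bar> \<le> (2 + 2 * \<alpha>) * (real n - real s)"
proof -
  let ?t = "real n - real s"
  have c: "0 \<le> crossings p s n i" "crossings p s n i \<le> ?t" for i
    using crossings_bounds[OF assms(2), of p i] by auto
  have a: "0 \<le> \<alpha> * crossings p s n i" "\<alpha> * crossings p s n i \<le> \<alpha> * ?t" for i
    using c[of i] assms(1) by (auto intro: mult_left_mono)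
  show ?thesis
    unfolding Delta_diff
    using c(1)[of j] c(2)[of j] c(1)[of "j + 1"] c(2)[of "j + 1"] a(1)[of "j - 1"] a(2)[of "j - 1"]
      a(1)[of "j + 2"] a(2)[of "j + 2"]
    by (simp add: algebra_simps abs_le_iff)
qed

lemma Delta_bound:
  assumes "\<alpha> \<ge> 0"
  shows "\<bar>Delta \<alpha> p n j\<bar> \<le> (2 + 2 * \<alpha>) * real n"
  using Delta_lipschitz[OF assms, of 0 n p j] by (simp add: Delta_def)

text \<open>The deterministic rule extracted from the random walk, on the time window from \<open>s\<close> to \<open>T\<close>. No direction is
  prescribed at the two end sites, where confinement already forces the step, nor where the bias is at
  most \<open>S\<close> in absolute value: there the path may do anything.\<close>

definition guided :: "real \<Rightarrow> real \<Rightarrow> (nat \<Rightarrow> int) \<Rightarrow> int \<Rightarrow> int \<Rightarrow> nat \<Rightarrow> nat \<Rightarrow> bool" where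
  "guided \<alpha> S p a b s T \<longleftrightarrow>
     (\<forall>n\<in>{s..T}. a \<le> p n \<and> p n \<le> b) \<and>
     (\<forall>n\<in>{s..<T}. \<bar>p (Suc n) - p n\<bar> = 1 \<and>
        (a < p n \<and> p n < b \<longrightarrow>
           (Delta \<alpha> p n (p n) > S \<longrightarrow> p (Suc n) = p n + 1) \<and>
           (Delta \<alpha> p n (p n) < - S \<longrightarrow> p (Suc n) = p n - 1)))"

lemma guidedD:
  assumes "guided \<alpha> S p a b s T"
  shows "s \<le> n \<Longrightarrow> n \<le> T \<Longrightarrow> a \<le> p n" "s \<le> n \<Longrightarrow> n \<le> T \<Longrightarrow> p n \<le> b"
    "s \<le> n \<Longrightarrow> n < T \<Longrightarrow> \<bar>p (Suc n) - p n\<bar> = 1"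
    "s \<le> n \<Longrightarrow> n < T \<Longrightarrow> a < p n \<Longrightarrow> p n < b \<Longrightarrow> p (Suc n) = p n + 1 \<Longrightarrow> - S \<le> Delta \<alpha> p n (p n)"
    "s \<le> n \<Longrightarrow> n < T \<Longrightarrow> a < p n \<Longrightarrow> p n < b \<Longrightarrow> p (Suc n) = p n - 1 \<Longrightarrow> Delta \<alpha> p n (p n) \<le> S"
  using assms unfolding guided_def by (force, force, force, force, force)

lemma guided_sub:
  assumes "guided \<alpha> S p a b s T" "S \<le> S'" "s \<le> s'" "T' \<le> T" "a \<le> a'" "b' \<le> b"
    and "\<And>n. s' \<le> n \<Longrightarrow> n \<le> T' \<Longrightarrow> a' \<le> p n \<and> p n \<le> b'"
  shows "guided \<alpha> S' p a' b' s' T'"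
  unfolding guided_def
proof (intro conjI ballI impI)
  fix n assume n: "n \<in> {s'..T'}"
  show "a' \<le> p n" "p n \<le> b'" using assms(7) n by auto
next
  fix n assume n: "n \<in> {s'..<T'}"
  then have n': "n \<in> {s..<T}" using assms by auto
  then show "\<bar>p (Suc n) - p n\<bar> = 1" using assms(1) unfolding guided_def by blast
  assume "a' < p n \<and> p n < b'"
  then have i: "a < p n \<and> p n < b" using assms by auto
  show "p (Suc n) = p n + 1" if "Delta \<alpha> p n (p n) > S'"
    using assms(1,2) n' i that unfolding guided_def by fastforce
  show "p (Suc n) = p n - 1" if "Delta \<alpha> p n (p n) < - S'"
    using assms(1,2) n' i that unfolding guided_def by fastforce
qed

lemma guided_mirror:
  assumes "guided \<alpha> S p a b s T"
  shows "guided \<alpha> S (\<lambda>n. - p n) (- b) (- a) s T"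
  using assms unfolding guided_def Delta_mirror by (auto simp: abs_if split: if_splits)

text \<open>The interval has the sites \<open>a, \<dots>, a + k\<close> and the edges \<open>a + 1, \<dots>, a + k\<close>; only the \<open>k - 1\<close> inner
  sites compare two of these edges.\<close>

definition flat :: "real \<Rightarrow> (nat \<Rightarrow> int) \<Rightarrow> int \<Rightarrow> nat \<Rightarrow> nat \<Rightarrow> real \<Rightarrow> bool" where
  "flat \<alpha> p a k n S \<longleftrightarrow> (\<forall>i. 1 \<le> i \<and> i < k \<longrightarrow> \<bar>Delta \<alpha> p n (a + int i)\<bar> \<le> S)"

lemma flat_mono: "flat \<alpha> p a k n S \<Longrightarrow> S \<le> S' \<Longrightarrow> flat \<alpha> p a k n S'"
  unfolding flat_def by force

lemma flat_shift: "flat \<alpha> p a (Suc k) n S \<Longrightarrow> flat \<alpha> p (a + 1) k n S"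
  unfolding flat_def
proof (intro allI impI)
  fix i assume *: "\<forall>i. 1 \<le> i \<and> i < Suc k \<longrightarrow> \<bar>Delta \<alpha> p n (a + int i)\<bar> \<le> S" "1 \<le> i \<and> i < k"
  show "\<bar>Delta \<alpha> p n (a + 1 + int i)\<bar> \<le> S"
    using *(1)[rule_format, of "Suc i"] *(2) by (simp add: add.assoc)
qed

lemma flat_mirror:
  assumes "flat \<alpha> p a k n S"
  shows "flat \<alpha> (\<lambda>n. - p n) (- (a + int k)) k n S"
  unfolding flat_def
proof (intro allI impI)
  fix i assume i: "1 \<le> i \<and> i < k"
  have e: "- (- (a + int k) + int i) = a + int (k - i)" using i by auto
  then show "\<bar>Delta \<alpha> (\<lambda>n. - p n) n (- (a + int k) + int i)\<bar> \<le> S"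
    unfolding Delta_mirror e abs_minus_cancel using i
    by (intro assms[unfolded flat_def, rule_format]) auto
qed

lemma flat_later:
  assumes "flat \<alpha> p a k s S" "\<alpha> \<ge> 0" "s \<le> n"
  shows "flat \<alpha> p a k n (S + (2 + 2 * \<alpha>) * (real n - real s))"
  unfolding flat_def
proof (intro allI impI)
  fix i assume i: "1 \<le> i \<and> i < k"
  show "\<bar>Delta \<alpha> p n (a + int i)\<bar> \<le> S + (2 + 2 * \<alpha>) * (real n - real s)"
    using assms(1) i Delta_lipschitz[OF assms(2,3), of p "a + int i"] by (force simp: flat_def)
qed

lemma last_visit:
  fixes p :: "nat \<Rightarrow> int"
  assumes "s \<le> t" and "\<And>m. s \<le> m \<Longrightarrow> m < t \<Longrightarrow> \<bar>p (Suc m) - p m\<bar> = 1"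
    and "p s \<le> j" "j < p t"
  obtains v where "s \<le> v" "v < t" "p v = j" "\<And>m. v < m \<Longrightarrow> m \<le> t \<Longrightarrow> j < p m"
proof -
  let ?A = "{m. s \<le> m \<and> m \<le> t \<and> p m \<le> j}"
  have fin: "finite ?A" and ne: "?A \<noteq> {}" using assms by auto
  define v where "v = Max ?A"
  have vA: "v \<in> ?A" using Max_in[OF fin ne] by (simp add: v_def)
  have after: "j < p m" if "v < m" "m \<le> t" for m
  proof (rule ccontr)
    assume "\<not> j < p m"
    then have "m \<in> ?A" using that vA by auto
    then have "m \<le> v" using fin by (simp add: v_def)
    then show False using that by simp
  qed
  have vt: "v < t" using vA assms(4) by (cases "v = t") auto
  have "\<bar>p (Suc v) - p v\<bar> = 1" using assms(2) vA vt by auto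
  moreover have "j < p (Suc v)" using after[of "Suc v"] vt by simp
  ultimately have "p v = j" using vA by auto
  then show thesis using that vA vt after by blast
qed

lemma crossings_outside:
  assumes "guided \<alpha> S p a (a + int k) s T" "s \<le> n" "n \<le> T" "j \<le> a \<or> a + int k < j"
  shows "crossings p s n j = 0"
proof (rule crossings_eq_0[OF assms(2)])
  fix m assume "s \<le> m" "m < n"
  then show "\<not> crosses p m j"
    using guidedD(1,2)[OF assms(1), of m] guidedD(1,2)[OF assms(1), of "Suc m"] assms(3,4)
    by (auto simp: crosses_iff)
qed

section \<open>Balance and escape\<close>

context walk_params
begin

lemma profile_recurrence:
  "- \<alpha> * profile k i + profile k (i + 1) - profile k (i + 2) + \<alpha> * profile k (i + 3) = 0"
  using profile_potential[of k i] profile_potential[of k "i + 1"]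
  by (simp add: algebra_simps numeral_eq_Suc)

lemma weight_recurrence:
  "- \<alpha> * weight k i + weight k (i + 1) - weight k (i + 2) + \<alpha> * weight k (i + 3) = 0"
proof -
  have "- \<alpha> * weight k i + weight k (i + 1) - weight k (i + 2) + \<alpha> * weight k (i + 3)
    = (- \<alpha> * profile k i + profile k (i + 1) - profile k (i + 2) + \<alpha> * profile k (i + 3)) / (\<Sum>j=1..k. profile k j)"
    by (simp add: weight_def add_divide_distrib diff_divide_distrib)
  then show ?thesis unfolding profile_recurrence by simp
qed

text \<open>It is essential that \<open>C\<close> depends neither on the path nor on \<open>S\<close> nor on the length of the time
  window.\<close>

definition stable :: "nat \<Rightarrow> bool" where
  "stable k \<longleftrightarrow> (\<exists>C\<ge>1. \<forall>S p a s T n. 1 \<le> S \<longrightarrow> guided \<alpha> S p a (a + int k) s T \<longrightarrow> flat \<alpha> p a k s S \<longrightarrow>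
     s \<le> n \<longrightarrow> n \<le> T \<longrightarrow> flat \<alpha> p a k n (C * S))"

text \<open>The increments of the local times over the window, minus their expected share of the elapsed time, have sum zero
  and vanish outside the interval. Stability bounds their biases, so \<open>kernel_bound\<close> bounds them.\<close>

lemma balanced:
  assumes k: "1 \<le> k" and small: "real (k + 1) * \<omega> < 2 * pi" and "stable k"
  shows "\<exists>C\<ge>1. \<forall>S p a s T n i. 1 \<le> S \<longrightarrow> guided \<alpha> S p a (a + int k) s T \<longrightarrow> flat \<alpha> p a k s S \<longrightarrow>
     s \<le> n \<longrightarrow> n \<le> T \<longrightarrow> i \<le> k + 1 \<longrightarrow>
     \<bar>crossings p s n (a + int i) - (real n - real s) * weight k i\<bar> \<le> C * S"
proof -
  obtain C1 where C1: "C1 \<ge> 1" "\<And>S p a s T n. 1 \<le> S \<Longrightarrow> guided \<alpha> S p a (a + int k) s T \<Longrightarrow>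
    flat \<alpha> p a k s S \<Longrightarrow> s \<le> n \<Longrightarrow> n \<le> T \<Longrightarrow> flat \<alpha> p a k n (C1 * S)"
    using \<open>stable k\<close> unfolding stable_def by blast
  obtain C0 where C0: "C0 \<ge> 0" "\<And>d G i. d 0 = 0 \<Longrightarrow> d (k + 1) = 0 \<Longrightarrow> (\<Sum>i=1..k. d i) = 0 \<Longrightarrow>
     (\<And>i. i + 3 \<le> k + 1 \<Longrightarrow> \<bar>- \<alpha> * d i + d (i + 1) - d (i + 2) + \<alpha> * d (i + 3)\<bar> \<le> G) \<Longrightarrow> 0 \<le> G \<Longrightarrow>
     i \<in> {1..k} \<Longrightarrow> \<bar>d i\<bar> \<le> C0 * G"
    using kernel_bound[OF k small] by blast
  show ?thesis
  proof (intro exI[of _ "C0 * (C1 + 1) + 1"] conjI allI impI)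
    show "C0 * (C1 + 1) + 1 \<ge> 1" using C0(1) C1(1) by simp
    fix S p a s T n i
    assume S: "1 \<le> S" and g: "guided \<alpha> S p a (a + int k) s T" and fl: "flat \<alpha> p a k s S"
      and n: "s \<le> n" "n \<le> T" and i: "i \<le> k + 1"
    define d where "d i = crossings p s n (a + int i) - (real n - real s) * weight k i" for i
    define G where "G = (C1 + 1) * S"
    have ends: "d 0 = 0" "d (k + 1) = 0"
      using crossings_outside[OF g n, of a] crossings_outside[OF g n, of "a + int (k + 1)"]
      by (simp_all add: d_def del: of_nat_Suc of_nat_add)
    have sum: "(\<Sum>i=1..k. d i) = 0"
      using sum_crossings[of s n p a k] guidedD(1-3)[OF g] n weight_sum[OF k small]
      by (simp add: d_def sum_subtractf flip: sum_distrib_left)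
    have gap: "\<bar>- \<alpha> * d i + d (i + 1) - d (i + 2) + \<alpha> * d (i + 3)\<bar> \<le> G" if "i + 3 \<le> k + 1" for i
    proof -
      let ?j = "a + int (i + 1)"
      let ?t = "real n - real s"
      have "- \<alpha> * d i + d (i + 1) - d (i + 2) + \<alpha> * d (i + 3) = Delta \<alpha> p n ?j - Delta \<alpha> p s ?j
        - ?t * (- \<alpha> * weight k i + weight k (i + 1) - weight k (i + 2) + \<alpha> * weight k (i + 3))"
        unfolding Delta_diff by (simp add: d_def algebra_simps)
      then have "- \<alpha> * d i + d (i + 1) - d (i + 2) + \<alpha> * d (i + 3) = Delta \<alpha> p n ?j - Delta \<alpha> p s ?j"
        unfolding weight_recurrence by simp
      moreover have "1 \<le> i + 1 \<and> i + 1 < k" using that by simp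
      then have "\<bar>Delta \<alpha> p n ?j\<bar> \<le> C1 * S" "\<bar>Delta \<alpha> p s ?j\<bar> \<le> S"
        using C1(2)[OF S g fl n] fl unfolding flat_def by blast+
      ultimately show ?thesis by (simp add: G_def algebra_simps)
    qed
    have G0: "0 \<le> G" using S C1(1) by (simp add: G_def)
    have "\<bar>d i\<bar> \<le> C0 * G"
    proof (cases "i = 0 \<or> i = k + 1")
      case True
      then show ?thesis using ends C0(1) G0 by auto
    next
      case False
      then show ?thesis using C0(2)[OF ends sum gap G0, of i] i by auto
    qed
    also have "\<dots> \<le> (C0 * (C1 + 1) + 1) * S" using S by (simp add: G_def algebra_simps)
    finally show "\<bar>crossings p s n (a + int i) - (real n - real s) * weight k i\<bar> \<le> (C0 * (C1 + 1) + 1) * S"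
      by (simp add: d_def)
  qed
qed

text \<open>The assumption on the visits to \<open>a\<close> expresses that the walk is not driven out of the interval. By
  balance, the edge \<open>a + 1\<close> carries a positive proportion of all steps, so \<open>a\<close> is visited in every
  stretch of time of order \<open>S\<close>, and in between the bias changes by at most that order.\<close>

lemma exit_lower:
  assumes k: "1 \<le> k" and small: "real (k + 1) * \<omega> < 2 * pi" and "stable k"
  shows "\<exists>C\<ge>1. \<forall>S p a s T n. 1 \<le> S \<longrightarrow> guided \<alpha> S p a (a + int k) s T \<longrightarrow> flat \<alpha> p a k s S \<longrightarrow>
     (\<forall>m. s \<le> m \<longrightarrow> m < T \<longrightarrow> p m = a \<longrightarrow> - S \<le> Delta \<alpha> p m a) \<longrightarrow>
     s \<le> n \<longrightarrow> n \<le> T \<longrightarrow> min (Delta \<alpha> p s a) 0 - C * S \<le> Delta \<alpha> p n a"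
proof -
  obtain B where B: "B \<ge> 1" "\<And>S p a s T n i. 1 \<le> S \<Longrightarrow> guided \<alpha> S p a (a + int k) s T \<Longrightarrow> flat \<alpha> p a k s S \<Longrightarrow>
     s \<le> n \<Longrightarrow> n \<le> T \<Longrightarrow> i \<le> k + 1 \<Longrightarrow>
     \<bar>crossings p s n (a + int i) - (real n - real s) * weight k i\<bar> \<le> B * S"
    using balanced[OF assms] by blast
  define w where "w = weight k 1"
  have w: "w > 0" using weight_pos[of 1 k] k small by (simp add: w_def)
  define D where "D = 2 + 2 * \<alpha>"
  have D: "D > 0" using alpha_pos by (simp add: D_def)
  define C where "C = 1 + D * ((2 * B + 1) / w + 2)"
  show ?thesis
  proof (intro exI[of _ C] conjI allI impI)
    show "C \<ge> 1" using D B w by (simp add: C_def)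
    fix S p a s T n
    assume S: "1 \<le> S" and g: "guided \<alpha> S p a (a + int k) s T" and fl: "flat \<alpha> p a k s S"
      and bd: "\<forall>m. s \<le> m \<longrightarrow> m < T \<longrightarrow> p m = a \<longrightarrow> - S \<le> Delta \<alpha> p m a"
      and n: "s \<le> n" "n \<le> T"
    define \<tau> where "\<tau> = nat \<lceil>(2 * B + 1) * S / w\<rceil>"
    have nn: "(2 * B + 1) * S / w \<ge> 0" using B S w by simp
    then have \<tau>1: "(2 * B + 1) * S / w \<le> real \<tau>" and \<tau>2: "real \<tau> \<le> (2 * B + 1) * S / w + 1"
      by (simp_all add: \<tau>_def)
    have \<tau>3: "S + D * (real \<tau> + 1) \<le> C * S"
    proof -
      have "real \<tau> + 1 \<le> ((2 * B + 1) / w + 2) * S" using \<tau>2 S by (simp add: algebra_simps)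
      then have "D * (real \<tau> + 1) \<le> D * (((2 * B + 1) / w + 2) * S)" using D by simp
      then show ?thesis by (simp add: C_def algebra_simps)
    qed
    have lip: "Delta \<alpha> p v a - D * (real n - real v) \<le> Delta \<alpha> p n a" if "v \<le> n" for v
      using Delta_lipschitz[of \<alpha> v n p a] that alpha_pos unfolding D_def by linarith
    show "min (Delta \<alpha> p s a) 0 - C * S \<le> Delta \<alpha> p n a"
    proof (cases "n \<le> s + \<tau> + 1")
      case True
      then have "D * (real n - real s) \<le> D * (real \<tau> + 1)" using D by (intro mult_left_mono) auto
      then show ?thesis using lip[of s] n \<tau>3 S by linarith
    next
      case False
      \<comment> \<open>The window ends at \<open>n - 1\<close> so that the visit found in it precedes \<open>T\<close>, where the rule still applies.\<close>
      define m where "m = n - 1 - \<tau>"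
      have m: "s \<le> m" "m \<le> n - 1" "real (n - 1) - real m = real \<tau>" using False by (auto simp: m_def)
      have "\<bar>crossings p s m (a + 1) - (real m - real s) * w\<bar> \<le> B * S"
        "\<bar>crossings p s (n - 1) (a + 1) - (real (n - 1) - real s) * w\<bar> \<le> B * S"
        using B(2)[OF S g fl, of m 1] B(2)[OF S g fl, of "n - 1" 1] m n by (simp_all add: w_def)
      then have "crossings p s (n - 1) (a + 1) - crossings p s m (a + 1) \<ge> (real (n - 1) - real m) * w - 2 * (B * S)"
        by (simp add: algebra_simps)
      moreover have "real \<tau> * w \<ge> (2 * B + 1) * S" using \<tau>1 w by (simp add: field_simps)
      ultimately have "crossings p m (n - 1) (a + 1) \<ge> S"
        unfolding m(3) by (simp add: crossings_def algebra_simps)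
      then have "crossings p m (n - 1) (a + 1) \<noteq> 0" using S by linarith
      then obtain r where r: "m \<le> r" "r < n - 1" "crosses p r (a + 1)"
        using crossings_eq_0[OF m(2), of p "a + 1"] by blast
      define v where "v = (if p r = a then r else Suc r)"
      have v: "p v = a" "m \<le> v" "v < n" using r by (auto simp: v_def crosses_iff)
      have "- S \<le> Delta \<alpha> p v a" using bd v m n by auto
      moreover have "D * (real n - real v) \<le> D * (real \<tau> + 1)"
        using v m D False by (intro mult_left_mono) auto
      ultimately show ?thesis using lip[of v] v \<tau>3 by linarith
    qed
  qed
qed

lemma weight_drift:
  assumes k: "1 \<le> k" and small: "real (k + 2) * \<omega> < 2 * pi"
  shows "\<alpha> * weight k 2 - weight k 1 < 0"
proof -
  have s: "real (k + 1) * \<omega> < 2 * pi" using small omega_pos by (simp add: algebra_simps)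
  have "\<alpha> * weight k 2 - weight k 1 = (\<alpha> * profile k 2 - profile k 1) / (\<Sum>j=1..k. profile k j)"
    by (simp add: weight_def diff_divide_distrib)
  then show ?thesis
    using profile_drift[OF small] profile_sum_pos[OF k s] by (simp add: divide_neg_pos)
qed

text \<open>By \<open>balanced\<close> and \<open>weight_drift\<close>, the bias at the end site \<open>a\<close> decreases linearly in time, which
  contradicts \<open>exit_lower\<close> after a time of order \<open>S\<close>.\<close>

lemma exit_time:
  assumes k: "1 \<le> k" and small: "real (k + 2) * \<omega> < 2 * pi" and "stable k"
  shows "\<exists>C\<ge>1. \<forall>S p a s T. 1 \<le> S \<longrightarrow> s \<le> T \<longrightarrow> guided \<alpha> S p a (a + int k) s T \<longrightarrow> flat \<alpha> p a k s S \<longrightarrow>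
     (\<forall>m. s \<le> m \<longrightarrow> m < T \<longrightarrow> p m = a \<longrightarrow> - S \<le> Delta \<alpha> p m a) \<longrightarrow>
     Delta \<alpha> p s a \<le> S \<longrightarrow> real T - real s \<le> C * S"
proof -
  have small': "real (k + 1) * \<omega> < 2 * pi" using small omega_pos by (simp add: algebra_simps)
  obtain B where B: "B \<ge> 1" "\<And>S p a s T n i. 1 \<le> S \<Longrightarrow> guided \<alpha> S p a (a + int k) s T \<Longrightarrow> flat \<alpha> p a k s S \<Longrightarrow>
     s \<le> n \<Longrightarrow> n \<le> T \<Longrightarrow> i \<le> k + 1 \<Longrightarrow>
     \<bar>crossings p s n (a + int i) - (real n - real s) * weight k i\<bar> \<le> B * S"
    using balanced[OF k small' \<open>stable k\<close>] by blast
  obtain E where E: "E \<ge> 1" "\<And>S p a s T n. 1 \<le> S \<Longrightarrow> guided \<alpha> S p a (a + int k) s T \<Longrightarrow> flat \<alpha> p a k s S \<Longrightarrow>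
     (\<And>m. s \<le> m \<Longrightarrow> m < T \<Longrightarrow> p m = a \<Longrightarrow> - S \<le> Delta \<alpha> p m a) \<Longrightarrow>
     s \<le> n \<Longrightarrow> n \<le> T \<Longrightarrow> min (Delta \<alpha> p s a) 0 - E * S \<le> Delta \<alpha> p n a"
    using exit_lower[OF k small' \<open>stable k\<close>] by blast
  define \<delta> where "\<delta> = weight k 1 - \<alpha> * weight k 2"
  have \<delta>: "\<delta> > 0" using weight_drift[OF k small] by (simp add: \<delta>_def)
  define C where "C = (1 + E + (1 + \<alpha>) * B) / \<delta> + 1"
  show ?thesis
  proof (intro exI[of _ C] conjI allI impI)
    show "C \<ge> 1" using E B alpha_pos \<delta> by (simp add: C_def)
    fix S p a s T
    assume S: "1 \<le> S" and sT: "s \<le> T" and g: "guided \<alpha> S p a (a + int k) s T" and fl: "flat \<alpha> p a k s S"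
      and bd: "\<forall>m. s \<le> m \<longrightarrow> m < T \<longrightarrow> p m = a \<longrightarrow> - S \<le> Delta \<alpha> p m a"
      and up: "Delta \<alpha> p s a \<le> S"
    let ?t = "real T - real s"
    have c: "\<bar>crossings p s T (a + 1) - ?t * weight k 1\<bar> \<le> B * S"
      "\<bar>crossings p s T (a + 2) - ?t * weight k 2\<bar> \<le> B * S"
      using B(2)[OF S g fl sT, of 1] B(2)[OF S g fl sT, of 2] k by simp_all
    have "crossings p s T (a - 1) = 0" "crossings p s T a = 0"
      using crossings_outside[OF g sT] by auto
    then have "Delta \<alpha> p T a = Delta \<alpha> p s a - crossings p s T (a + 1) + \<alpha> * crossings p s T (a + 2)"
      using Delta_diff[of \<alpha> p T a s] by simp
    also have "\<dots> \<le> Delta \<alpha> p s a - (?t * weight k 1 - B * S) + \<alpha> * (?t * weight k 2 + B * S)"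
      using c alpha_pos by (intro add_mono mult_left_mono diff_mono) auto
    also have "\<dots> = Delta \<alpha> p s a - ?t * \<delta> + (1 + \<alpha>) * B * S"
      by (simp add: \<delta>_def algebra_simps)
    finally have "min (Delta \<alpha> p s a) 0 - E * S \<le> Delta \<alpha> p s a - ?t * \<delta> + (1 + \<alpha>) * B * S"
      using E(2)[OF S g fl, of T] bd sT by force
    then have "?t * \<delta> \<le> (1 + E + (1 + \<alpha>) * B) * S"
      using up S by (simp add: algebra_simps)
    then have "?t \<le> (1 + E + (1 + \<alpha>) * B) / \<delta> * S" using \<delta> by (simp add: field_simps)
    also have "\<dots> \<le> C * S" using S by (simp add: C_def algebra_simps)
    finally show "?t \<le> C * S" .
  qed
qed

end

section \<open>One sweep flattens the potential\<close>

text \<open>At the last visit to an inner site the walk steps right, so the bias there is at least \<open>- S\<close>.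
  Afterwards the walk stays to the right of that site: the edge just entered is not crossed again,
  and crossings of the next one only increase the bias.\<close>

lemma rightmost_gaps:
  assumes g: "guided \<alpha> S p a (a + int k) s T" and "0 \<le> \<alpha>" and sT: "s \<le> T"
    and ps: "p s = a" and pT: "p T = a + int k" and i: "1 \<le> i" "i < k"
  shows "- S - 1 \<le> Delta \<alpha> p T (a + int i)"
proof -
  define j where "j = a + int i"
  obtain v where v: "s \<le> v" "v < T" "p v = j" and after: "\<And>m. v < m \<Longrightarrow> m \<le> T \<Longrightarrow> j < p m"
    using last_visit[of s T p j] guidedD(3)[OF g] sT ps pT i unfolding j_def by auto
  have "p (Suc v) = p v + 1"
    using after[of "Suc v"] guidedD(3)[OF g v(1,2)] v by auto
  then have low: "- S \<le> Delta \<alpha> p v j"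
    using guidedD(4)[OF g v(1,2)] i v(3) by (simp add: j_def)
  have no: "\<not> crosses p m l" if "v \<le> m" "m < T" "l \<le> j \<or> l = j + 1 \<and> v < m" for m l
    using after[of "Suc m"] after[of m] that by (auto simp: crosses_iff)
  have "crossings p v T (j - 1) = 0" "crossings p v T j = 0" "crossings p (Suc v) T (j + 1) = 0"
    using v no by (auto intro!: crossings_eq_0)
  moreover have "crossings p v T (j + 1) = crossings p v (Suc v) (j + 1) + crossings p (Suc v) T (j + 1)"
    by (simp add: crossings_def)
  moreover have "crossings p v (Suc v) (j + 1) \<le> 1"
    using crossings_bounds[of v "Suc v" p "j + 1"] by simp
  moreover have "0 \<le> \<alpha> * crossings p v T (j + 2)"
    using crossings_bounds[of v T p "j + 2"] v assms(2) by simp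
  ultimately have "Delta \<alpha> p T j \<ge> Delta \<alpha> p v j - 1"
    using Delta_diff[of \<alpha> p T j v] by simp
  then show ?thesis using low by (simp add: j_def)
qed

text \<open>Before the first visit to \<open>b\<close> none of the edges up to \<open>b + 1\<close> is crossed; the visit itself uses
  \<open>b + 1\<close> once, and crossings of \<open>b + 2\<close> increase the bias at \<open>b\<close>.\<close>

lemma first_hit_gap:
  assumes g: "guided \<alpha> S p b c s r" and "0 \<le> \<alpha>" and sr: "s < r"
    and first: "\<And>n. s \<le> n \<Longrightarrow> n < r \<Longrightarrow> p n \<noteq> b"
  shows "Delta \<alpha> p s b - 1 \<le> Delta \<alpha> p r b"
proof -
  have lo: "b \<le> p n" if "s \<le> n" "n \<le> r" for n using guidedD(1)[OF g that] .
  have no: "\<not> crosses p m l" if "s \<le> m" "m < r" "l \<le> b \<or> l = b + 1 \<and> Suc m < r" for m l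
    using lo[of m] lo[of "Suc m"] first[of m] first[of "Suc m"] that by (auto simp: crosses_iff)
  have "crossings p s r (b - 1) = 0" "crossings p s r b = 0" "crossings p s (r - 1) (b + 1) = 0"
    using sr no by (auto intro!: crossings_eq_0)
  moreover have "crossings p s r (b + 1) = crossings p s (r - 1) (b + 1) + crossings p (r - 1) r (b + 1)"
    by (simp add: crossings_def)
  moreover have "crossings p (r - 1) r (b + 1) \<le> 1"
    using crossings_bounds[of "r - 1" r p "b + 1"] sr by simp
  moreover have "0 \<le> \<alpha> * crossings p s r (b + 2)"
    using crossings_bounds[of s r p "b + 2"] sr assms(2) by simp
  ultimately show ?thesis
    using Delta_diff[of \<alpha> p r b s] by simp
qed

context walk_params
begin

text \<open>One traversal from the right end to the left end flattens the potential. The lower bound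
  on the initial biases says that the potential is nearly nonincreasing; it is one-sided, so the
  potential may be arbitrarily steep, and \<open>C\<close> does not depend on the steepness.\<close>

definition sweeping :: "nat \<Rightarrow> bool" where
  "sweeping k \<longleftrightarrow> (\<exists>C\<ge>1. \<forall>S p a s T. 1 \<le> S \<longrightarrow> s \<le> T \<longrightarrow> guided \<alpha> S p a (a + int k) s T \<longrightarrow>
     p s = a + int k \<longrightarrow> p T = a \<longrightarrow> (\<forall>n. s \<le> n \<longrightarrow> n < T \<longrightarrow> p n \<noteq> a) \<longrightarrow>
     (\<forall>i. 1 \<le> i \<longrightarrow> i < k \<longrightarrow> - S \<le> Delta \<alpha> p s (a + int i)) \<longrightarrow> flat \<alpha> p a k T (C * S))"

text \<open>The traversal is split at the first visit \<open>r\<close> to the site \<open>a + 1\<close>. Up to \<open>r\<close> it is a traversal of the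
  \<open>k\<close> edges on the right, so the potential is flat there at time \<open>r\<close>, and stability keeps it
  flat until the walk steps to \<open>a\<close>. The remaining bias, at \<open>a + 1\<close>, is at most \<open>S\<close> because the walk
  finally steps left from there, and it cannot be much below \<open>- S\<close> by \<open>exit_lower\<close>.\<close>

lemma sweeping_Suc:
  assumes k: "1 \<le> k" and small: "real (k + 1) * \<omega> < 2 * pi" and "stable k" and "sweeping k"
  shows "sweeping (Suc k)"
proof -
  obtain C1 where C1: "C1 \<ge> 1" "\<And>S p a s T. 1 \<le> S \<Longrightarrow> s \<le> T \<Longrightarrow> guided \<alpha> S p a (a + int k) s T \<Longrightarrow>
     p s = a + int k \<Longrightarrow> p T = a \<Longrightarrow> (\<And>n. s \<le> n \<Longrightarrow> n < T \<Longrightarrow> p n \<noteq> a) \<Longrightarrow>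
     (\<And>i. 1 \<le> i \<Longrightarrow> i < k \<Longrightarrow> - S \<le> Delta \<alpha> p s (a + int i)) \<Longrightarrow> flat \<alpha> p a k T (C1 * S)"
    using \<open>sweeping k\<close> unfolding sweeping_def by blast
  obtain C2 where C2: "C2 \<ge> 1" "\<And>S p a s T n. 1 \<le> S \<Longrightarrow> guided \<alpha> S p a (a + int k) s T \<Longrightarrow>
    flat \<alpha> p a k s S \<Longrightarrow> s \<le> n \<Longrightarrow> n \<le> T \<Longrightarrow> flat \<alpha> p a k n (C2 * S)"
    using \<open>stable k\<close> unfolding stable_def by blast
  obtain E where E: "E \<ge> 1" "\<And>S p a s T n. 1 \<le> S \<Longrightarrow> guided \<alpha> S p a (a + int k) s T \<Longrightarrow> flat \<alpha> p a k s S \<Longrightarrow>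
     (\<And>m. s \<le> m \<Longrightarrow> m < T \<Longrightarrow> p m = a \<Longrightarrow> - S \<le> Delta \<alpha> p m a) \<Longrightarrow>
     s \<le> n \<Longrightarrow> n \<le> T \<Longrightarrow> min (Delta \<alpha> p s a) 0 - E * S \<le> Delta \<alpha> p n a"
    using exit_lower[OF k small \<open>stable k\<close>] by blast
  define K where "K = 2 + E * C1 + C2 * C1"
  define C where "C = K + (2 + 2 * \<alpha>)"
  show ?thesis unfolding sweeping_def
  proof (intro exI[of _ C] conjI allI impI)
    have "E * C1 \<ge> 0" "C2 * C1 \<ge> 0" using E C1 C2 by simp_all
    then show "C \<ge> 1" using alpha_pos by (simp add: C_def K_def)
    fix S p a s T
    assume S: "1 \<le> S" and sT: "s \<le> T" and g: "guided \<alpha> S p a (a + int (Suc k)) s T"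
      and ps: "p s = a + int (Suc k)" and pT: "p T = a" and first: "\<forall>n. s \<le> n \<longrightarrow> n < T \<longrightarrow> p n \<noteq> a"
      and low: "\<forall>i. 1 \<le> i \<longrightarrow> i < Suc k \<longrightarrow> - S \<le> Delta \<alpha> p s (a + int i)"
    have sT': "s < T" using ps pT sT by (cases "s = T") auto
    have above: "a + 1 \<le> p n" if "s \<le> n" "n < T" for n
      using guidedD(1)[OF g, of n] first that by force
    define T' where "T' = T - 1"
    have T': "s \<le> T'" "Suc T' = T" "T' < T" using sT' by (simp_all add: T'_def)
    have pT': "p T' = a + 1"
      using guidedD(3)[OF g T'(1,3)] above[OF T'(1,3)] T' pT by auto
    define r where "r = (LEAST n. s \<le> n \<and> p n = a + 1)"
    have r: "s \<le> r" "p r = a + 1" "r \<le> T'"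
      using LeastI[of "\<lambda>n. s \<le> n \<and> p n = a + 1" T'] Least_le[of "\<lambda>n. s \<le> n \<and> p n = a + 1" T'] T' pT'
      by (auto simp: r_def)
    have before: "p n \<noteq> a + 1" if "s \<le> n" "n < r" for n
      using not_less_Least[of n "\<lambda>n. s \<le> n \<and> p n = a + 1"] that by (auto simp: r_def)
    have sr: "s < r" using r ps k by (cases "s = r") auto
    have conf: "a + 1 \<le> p n \<and> p n \<le> a + 1 + int k" if "s \<le> n" "n \<le> T'" for n
      using above[of n] guidedD(2)[OF g, of n] that T' by auto
    have g1: "guided \<alpha> S p (a + 1) (a + 1 + int k) s r"
      by (rule guided_sub[OF g]) (use r T' conf in auto)
    have f1: "flat \<alpha> p (a + 1) k r (C1 * S)"
    proof (rule C1(2)[OF S r(1) g1])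
      fix i assume "1 \<le> i" "i < k"
      then show "- S \<le> Delta \<alpha> p s (a + 1 + int i)"
        using low[rule_format, of "Suc i"] by (simp add: add.assoc)
    qed (use ps r before in auto)
    have S1: "1 \<le> C1 * S" "S \<le> C1 * S" using S C1(1) mult_mono[of 1 C1 1 S] by auto
    have g2: "guided \<alpha> (C1 * S) p (a + 1) (a + 1 + int k) r T'"
      by (rule guided_sub[OF g]) (use r T' conf S1 in auto)
    have f2: "flat \<alpha> p (a + 1) k T' (C2 * (C1 * S))"
      using C2(2)[OF S1(1) g2 f1 r(3)] by simp
    have bd: "- (C1 * S) \<le> Delta \<alpha> p m (a + 1)" if "r \<le> m" "m < T'" "p m = a + 1" for m
    proof -
      have "p (Suc m) = p m + 1"
        using guidedD(3)[OF g, of m] above[of "Suc m"] that r T' by auto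
      then have "- S \<le> Delta \<alpha> p m (p m)"
        using guidedD(4)[OF g, of m] that r T' k by auto
      then show ?thesis using that S1 by simp
    qed
    have "min (Delta \<alpha> p r (a + 1)) 0 - E * (C1 * S) \<le> Delta \<alpha> p T' (a + 1)"
      by (rule E(2)[OF S1(1) g2 f1]) (use bd r(3) in auto)
    moreover have "- S - 1 \<le> Delta \<alpha> p r (a + 1)"
      using first_hit_gap[OF g1 _ sr before] alpha_pos low[rule_format, of 1] k by simp
    ultimately have "- S - 1 - E * (C1 * S) \<le> Delta \<alpha> p T' (a + 1)"
      using S by (simp add: min_def split: if_splits)
    moreover have "K * S = 2 * S + E * (C1 * S) + C2 * (C1 * S)" by (simp add: K_def algebra_simps)
    moreover have "0 \<le> C2 * (C1 * S)" using S1 C2(1) by simp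
    ultimately have lo: "- (K * S) \<le> Delta \<alpha> p T' (a + 1)" using S by linarith
    have "Delta \<alpha> p T' (a + 1) \<le> S"
      using guidedD(5)[OF g T'(1,3)] pT' T' pT k by auto
    moreover have "S \<le> K * S" using S C1(1) C2(1) E(1) mult_right_mono[of 1 K S] by (simp add: K_def)
    ultimately have one: "\<bar>Delta \<alpha> p T' (a + 1)\<bar> \<le> K * S" using lo by linarith
    have "C2 * (C1 * S) \<le> K * S"
      using S E(1) C1(1) by (simp add: K_def algebra_simps)
    then have f2': "flat \<alpha> p (a + 1) k T' (K * S)" by (rule flat_mono[OF f2])
    have "flat \<alpha> p a (Suc k) T' (K * S)" unfolding flat_def
    proof (intro allI impI)
      fix i assume i: "1 \<le> i \<and> i < Suc k"
      show "\<bar>Delta \<alpha> p T' (a + int i)\<bar> \<le> K * S"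
      proof (cases "i = 1")
        case False
        then have "1 \<le> i - 1 \<and> i - 1 < k" using i by auto
        then show ?thesis
          using f2'[unfolded flat_def, rule_format, of "i - 1"] i by (auto simp: of_nat_diff)
      qed (use one in simp)
    qed
    then have "flat \<alpha> p a (Suc k) T (K * S + (2 + 2 * \<alpha>) * (real T - real T'))"
      by (rule flat_later) (use alpha_pos T' in auto)
    moreover have "real T - real T' = 1" using T'(2) by auto
    ultimately have "flat \<alpha> p a (Suc k) T (K * S + (2 + 2 * \<alpha>))" by simp
    moreover have "(2 + 2 * \<alpha>) * 1 \<le> (2 + 2 * \<alpha>) * S" using S alpha_pos by (intro mult_left_mono) auto
    ultimately show "flat \<alpha> p a (Suc k) T (C * S)"
      by (elim flat_mono) (simp add: C_def algebra_simps)
  qed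
qed

section \<open>Stability\<close>

text \<open>While the left end is avoided, the path lives on \<open>k\<close> edges and \<open>exit_time\<close> applies to the site
  \<open>a + 1\<close>.\<close>

lemma reach_left:
  assumes k: "1 \<le> k" and small: "real (k + 2) * \<omega> < 2 * pi" and "stable k"
  shows "\<exists>C\<ge>1. \<forall>S p a s T. 1 \<le> S \<longrightarrow> guided \<alpha> S p a (a + int (Suc k)) s T \<longrightarrow>
     flat \<alpha> p a (Suc k) s S \<longrightarrow> real s + C * S \<le> real T \<longrightarrow>
     (\<exists>t. s \<le> t \<and> t \<le> T \<and> p t = a \<and> real t \<le> real s + C * S)"
proof -
  obtain E where E: "E \<ge> 1" "\<And>S p a s T. 1 \<le> S \<Longrightarrow> s \<le> T \<Longrightarrow> guided \<alpha> S p a (a + int k) s T \<Longrightarrow>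
     flat \<alpha> p a k s S \<Longrightarrow> (\<And>m. s \<le> m \<Longrightarrow> m < T \<Longrightarrow> p m = a \<Longrightarrow> - S \<le> Delta \<alpha> p m a) \<Longrightarrow>
     Delta \<alpha> p s a \<le> S \<Longrightarrow> real T - real s \<le> E * S"
    using exit_time[OF assms] by blast
  show ?thesis
  proof (intro exI[of _ "E + 1"] conjI allI impI)
    show "E + 1 \<ge> 1" using E by simp
    fix S p a s T
    assume S: "1 \<le> S" and g: "guided \<alpha> S p a (a + int (Suc k)) s T"
      and fl: "flat \<alpha> p a (Suc k) s S" and long: "real s + (E + 1) * S \<le> real T"
    have ES: "(E + 1) * S = E * S + S" "E * S \<ge> 0" using S E by (simp_all add: algebra_simps)
    have sT: "s \<le> T" using long ES S by linarith
    have *: "real T' - real s \<le> E * S"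
      if T': "s \<le> T'" "T' \<le> T" and avoid: "\<And>n. s \<le> n \<Longrightarrow> n \<le> T' \<Longrightarrow> p n \<noteq> a" for T'
    proof (rule E(2)[OF S T'(1)])
      have conf: "a + 1 \<le> p n \<and> p n \<le> a + 1 + int k" if "s \<le> n" "n \<le> T'" for n
        using guidedD(1,2)[OF g, of n] avoid[OF that] that T' by auto
      show "guided \<alpha> S p (a + 1) (a + 1 + int k) s T'"
        by (rule guided_sub[OF g]) (use T' conf in auto)
      show "flat \<alpha> p (a + 1) k s S" using fl by (rule flat_shift)
      show "Delta \<alpha> p s (a + 1) \<le> S" using fl[unfolded flat_def, rule_format, of 1] k by simp
      show "- S \<le> Delta \<alpha> p m (a + 1)" if "s \<le> m" "m < T'" "p m = a + 1" for m
      proof -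
        have "p (Suc m) = p m + 1"
          using guidedD(3)[OF g, of m] avoid[of "Suc m"] that T' by auto
        then show ?thesis
          using guidedD(4)[OF g, of m] that T' k by auto
      qed
    qed
    have "\<exists>t. s \<le> t \<and> t \<le> T \<and> p t = a"
    proof (rule ccontr)
      assume "\<not> ?thesis"
      then have "real T - real s \<le> E * S" using sT by (intro *) auto
      then show False using long ES S by linarith
    qed
    then obtain t' where t': "s \<le> t' \<and> t' \<le> T \<and> p t' = a" by blast
    define t where "t = (LEAST t. s \<le> t \<and> t \<le> T \<and> p t = a)"
    have t: "s \<le> t" "t \<le> T" "p t = a"
      using LeastI[of "\<lambda>t. s \<le> t \<and> t \<le> T \<and> p t = a", OF t'] by (auto simp: t_def)
    have before: "p n \<noteq> a" if "s \<le> n" "n < t" for n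
      using not_less_Least[of n "\<lambda>t. s \<le> t \<and> t \<le> T \<and> p t = a"] that t by (auto simp: t_def)
    have "real t \<le> real s + (E + 1) * S"
    proof (cases "t = s")
      case False
      then have "real (t - 1) - real s \<le> E * S" using t before by (intro *) auto
      then show ?thesis using ES S False t by (auto simp: of_nat_diff)
    qed (use ES S in linarith)
    then show "\<exists>t. s \<le> t \<and> t \<le> T \<and> p t = a \<and> real t \<le> real s + (E + 1) * S"
      using t by blast
  qed
qed

lemma reach_right:
  assumes k: "1 \<le> k" and small: "real (k + 2) * \<omega> < 2 * pi" and "stable k"
  shows "\<exists>C\<ge>1. \<forall>S p a s T. 1 \<le> S \<longrightarrow> guided \<alpha> S p a (a + int (Suc k)) s T \<longrightarrow>
     flat \<alpha> p a (Suc k) s S \<longrightarrow> real s + C * S \<le> real T \<longrightarrow>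
     (\<exists>t. s \<le> t \<and> t \<le> T \<and> p t = a + int (Suc k) \<and> real t \<le> real s + C * S)"
proof -
  obtain C where C: "C \<ge> 1" "\<And>S p a s T. 1 \<le> S \<Longrightarrow> guided \<alpha> S p a (a + int (Suc k)) s T \<Longrightarrow>
     flat \<alpha> p a (Suc k) s S \<Longrightarrow> real s + C * S \<le> real T \<Longrightarrow>
     (\<exists>t. s \<le> t \<and> t \<le> T \<and> p t = a \<and> real t \<le> real s + C * S)"
    using reach_left[OF assms] by blast
  show ?thesis
  proof (intro exI[of _ C] conjI allI impI C(1))
    fix S p a s T
    assume S: "1 \<le> S" and g: "guided \<alpha> S p a (a + int (Suc k)) s T"
      and fl: "flat \<alpha> p a (Suc k) s S" and long: "real s + C * S \<le> real T"
    let ?a = "- (a + int (Suc k))"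
    have g': "guided \<alpha> S (\<lambda>n. - p n) ?a (?a + int (Suc k)) s T"
      using guided_mirror[OF g] by simp
    obtain t where "s \<le> t" "t \<le> T" "- p t = ?a" "real t \<le> real s + C * S"
      using C(2)[OF S g' flat_mirror[OF fl] long] by blast
    moreover from this have "p t = a + int (Suc k)" by linarith
    ultimately show "\<exists>t. s \<le> t \<and> t \<le> T \<and> p t = a + int (Suc k) \<and> real t \<le> real s + C * S"
      by blast
  qed
qed

text \<open>Starting from a moment at which the biases are at most \<open>C0 S\<close>, the walk visits the left end, then
  the right end, then the left end again, each time after a delay proportional to the current
  biases, hence to \<open>S\<close>. By then the biases are again at most \<open>C0 S\<close>, with the same \<open>C0\<close>,
  since the constant of a sweep does not depend on what happened before it. So such moments
  recur within a bounded multiple of \<open>S\<close>, and the Lipschitz bound covers the time between them.\<close>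

lemma stable_Suc:
  assumes k: "1 \<le> k" and small: "real (k + 2) * \<omega> < 2 * pi" and "stable k" and "sweeping (Suc k)"
  shows "stable (Suc k)"
proof -
  obtain CL where CL: "CL \<ge> 1" "\<And>S p a s T. 1 \<le> S \<Longrightarrow> guided \<alpha> S p a (a + int (Suc k)) s T \<Longrightarrow>
     flat \<alpha> p a (Suc k) s S \<Longrightarrow> real s + CL * S \<le> real T \<Longrightarrow>
     (\<exists>t. s \<le> t \<and> t \<le> T \<and> p t = a \<and> real t \<le> real s + CL * S)"
    using reach_left[OF assms(1-3)] by blast
  obtain CR where CR: "CR \<ge> 1" "\<And>S p a s T. 1 \<le> S \<Longrightarrow> guided \<alpha> S p a (a + int (Suc k)) s T \<Longrightarrow>
     flat \<alpha> p a (Suc k) s S \<Longrightarrow> real s + CR * S \<le> real T \<Longrightarrow>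
     (\<exists>t. s \<le> t \<and> t \<le> T \<and> p t = a + int (Suc k) \<and> real t \<le> real s + CR * S)"
    using reach_right[OF assms(1-3)] by blast
  obtain CQ where CQ: "CQ \<ge> 1" "\<And>S p a s T. 1 \<le> S \<Longrightarrow> s \<le> T \<Longrightarrow> guided \<alpha> S p a (a + int (Suc k)) s T \<Longrightarrow>
     p s = a + int (Suc k) \<Longrightarrow> p T = a \<Longrightarrow> (\<And>n. s \<le> n \<Longrightarrow> n < T \<Longrightarrow> p n \<noteq> a) \<Longrightarrow>
     (\<And>i. 1 \<le> i \<Longrightarrow> i < Suc k \<Longrightarrow> - S \<le> Delta \<alpha> p s (a + int i)) \<Longrightarrow> flat \<alpha> p a (Suc k) T (CQ * S)"
    using \<open>sweeping (Suc k)\<close> unfolding sweeping_def by blast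
  define D where "D = 2 + 2 * \<alpha>"
  have D: "D \<ge> 0" using alpha_pos by (simp add: D_def)
  \<comment> \<open>The factor 2 absorbs the additional 1 in \<open>rightmost_gaps\<close>.\<close>
  define C0 where "C0 = 2 * CQ"
  have C0: "C0 \<ge> 1" using CQ by (simp add: C0_def)
  define K1 where "K1 = C0 * (1 + D * CL)"
  have K1: "K1 \<ge> 1" using C0 D CL mult_mono[of 1 C0 1 "1 + D * CL"] by (simp add: K1_def)
  define K2 where "K2 = K1 * (1 + D * CR)"
  have K2: "K2 \<ge> 1" using K1 D CR mult_mono[of 1 K1 1 "1 + D * CR"] by (simp add: K2_def)
  define C1 where "C1 = CL * C0 + CR * K1 + CL * K2"
  have next_flat: "\<exists>t'. t < t' \<and> t' \<le> T \<and> flat \<alpha> p a (Suc k) t' (C0 * S)"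
    if S: "1 \<le> S" and g: "guided \<alpha> S p a (a + int (Suc k)) t T" and fl: "flat \<alpha> p a (Suc k) t (C0 * S)"
      and long: "real t + C1 * S \<le> real T" for S p a t T
  proof -
    have later: "guided \<alpha> (c * S) p a (a + int (Suc k)) t' T" if "t \<le> t'" "1 \<le> c" for t' c
      by (rule guided_sub[OF g]) (use that S guidedD(1,2)[OF g] in auto)
    have ge1: "1 \<le> c * S" if "1 \<le> c" for c using that S mult_mono[of 1 c 1 S] by simp
    have nn: "0 \<le> CL * (C0 * S)" "0 \<le> CR * (K1 * S)" "0 \<le> CL * (K2 * S)"
      using CL(1) CR(1) C0 K1 K2 S by simp_all
    have long': "real t + CL * (C0 * S) + CR * (K1 * S) + CL * (K2 * S) \<le> real T"
      using long by (simp add: C1_def algebra_simps)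
    obtain t0 where t0: "t \<le> t0" "t0 \<le> T" "p t0 = a" "real t0 \<le> real t + CL * (C0 * S)"
      using CL(2)[OF ge1[OF C0] later[OF order_refl C0] fl] long' nn by auto
    have "C0 * S + D * (real t0 - real t) \<le> C0 * S + D * (CL * (C0 * S))"
      using t0 D by (intro add_left_mono mult_left_mono) auto
    also have "\<dots> = K1 * S" by (simp add: K1_def algebra_simps)
    finally have f0: "flat \<alpha> p a (Suc k) t0 (K1 * S)"
      using flat_later[OF fl _ t0(1)] alpha_pos by (auto simp: D_def elim: flat_mono)
    obtain t1 where t1: "t0 \<le> t1" "t1 \<le> T" "p t1 = a + int (Suc k)" "real t1 \<le> real t0 + CR * (K1 * S)"
      using CR(2)[OF ge1[OF K1] later[OF t0(1) K1] f0] long' nn t0 by auto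
    have "K1 * S + D * (real t1 - real t0) \<le> K1 * S + D * (CR * (K1 * S))"
      using t1 D by (intro add_left_mono mult_left_mono) auto
    also have "\<dots> = K2 * S" by (simp add: K2_def algebra_simps)
    finally have f1: "flat \<alpha> p a (Suc k) t1 (K2 * S)"
      using flat_later[OF f0 _ t1(1)] alpha_pos by (auto simp: D_def elim: flat_mono)
    have tt1: "t \<le> t1" using t0 t1 by simp
    obtain t2' where t2': "t1 \<le> t2'" "t2' \<le> T" "p t2' = a"
      using CL(2)[OF ge1[OF K2] later[OF tt1 K2] f1] long' nn t0 t1 by auto
    define t2 where "t2 = (LEAST n. t1 \<le> n \<and> p n = a)"
    have t2: "t1 \<le> t2" "t2 \<le> T" "p t2 = a"
      using LeastI[of "\<lambda>n. t1 \<le> n \<and> p n = a" t2'] Least_le[of "\<lambda>n. t1 \<le> n \<and> p n = a" t2'] t2'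
      by (auto simp: t2_def)
    have first: "p n \<noteq> a" if "t1 \<le> n" "n < t2" for n
      using not_less_Least[of n "\<lambda>n. t1 \<le> n \<and> p n = a"] that by (auto simp: t2_def)
    have g01: "guided \<alpha> S p a (a + int (Suc k)) t0 t1"
      by (rule guided_sub[OF g]) (use t0 t1 guidedD(1,2)[OF g] in auto)
    have g12: "guided \<alpha> (2 * S) p a (a + int (Suc k)) t1 t2"
      by (rule guided_sub[OF g]) (use S t0 t1 t2 guidedD(1,2)[OF g] in auto)
    have "flat \<alpha> p a (Suc k) t2 (CQ * (2 * S))"
    proof (rule CQ(2)[OF _ t2(1) g12 t1(3) t2(3)])
      show "p n \<noteq> a" if "t1 \<le> n" "n < t2" for n using first that .
      show "1 \<le> 2 * S" using S by simp
      show "- (2 * S) \<le> Delta \<alpha> p t1 (a + int i)" if "1 \<le> i" "i < Suc k" for i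
        using rightmost_gaps[OF g01 _ t1(1) t0(3) t1(3) that] alpha_pos S by simp
    qed
    then have "flat \<alpha> p a (Suc k) t2 (C0 * S)" by (simp add: C0_def mult.assoc mult.left_commute)
    moreover have "t0 \<noteq> t1" using t0(3) t1(3) by auto
    then have "t < t2" using t0 t1 t2 by simp
    ultimately show ?thesis using t2 by blast
  qed
  show ?thesis unfolding stable_def
  proof (intro exI[of _ "C0 + D * C1"] conjI allI impI)
    have C1: "C1 \<ge> 0" using CL(1) CR(1) C0 K1 K2 by (simp add: C1_def)
    then show "C0 + D * C1 \<ge> 1" using C0 D by (simp add: add_increasing2)
    fix S p a s T n
    assume S: "1 \<le> S" and g: "guided \<alpha> S p a (a + int (Suc k)) s T" and fl: "flat \<alpha> p a (Suc k) s S"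
      and n: "s \<le> n" "n \<le> T"
    let ?A = "{t. s \<le> t \<and> t \<le> n \<and> flat \<alpha> p a (Suc k) t (C0 * S)}"
    have "S \<le> C0 * S" using S C0 by simp
    then have "s \<in> ?A" using n flat_mono[OF fl] by auto
    moreover have fin: "finite ?A" by simp
    ultimately have "Max ?A \<in> ?A" by (intro Max_in) auto
    define t where "t = Max ?A"
    have t: "s \<le> t" "t \<le> n" "flat \<alpha> p a (Suc k) t (C0 * S)"
      using \<open>Max ?A \<in> ?A\<close> by (auto simp: t_def)
    have gt: "guided \<alpha> S p a (a + int (Suc k)) t n"
      by (rule guided_sub[OF g]) (use t n guidedD(1,2)[OF g] in auto)
    have "\<not> real t + C1 * S \<le> real n"
    proof
      assume "real t + C1 * S \<le> real n"
      then obtain t' where "t < t'" "t' \<le> n" "flat \<alpha> p a (Suc k) t' (C0 * S)"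
        using next_flat[OF S gt t(3)] by blast
      then have "t' \<in> ?A" "t < t'" using t by auto
      then show False using Max_ge[OF fin] by (fastforce simp: t_def)
    qed
    then have "D * (real n - real t) \<le> D * (C1 * S)" using D by (intro mult_left_mono) auto
    then show "flat \<alpha> p a (Suc k) n ((C0 + D * C1) * S)"
      using flat_later[OF t(3) _ t(2)] alpha_pos by (auto simp: D_def algebra_simps elim: flat_mono)
  qed
qed

lemma stable_and_sweeping:
  assumes "1 \<le> k" "real (k + 1) * \<omega> < 2 * pi"
  shows "stable k \<and> sweeping k"
  using assms
proof (induction k rule: nat_induct_at_least)
  case base
  show ?case unfolding stable_def sweeping_def flat_def by (auto intro: exI[of _ 1])
next
  case (Suc k)
  have "real (k + 1) * \<omega> < 2 * pi" using Suc.prems omega_pos by (simp add: algebra_simps)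
  then show ?case using Suc sweeping_Suc stable_Suc by simp
qed

section \<open>Asymptotics of a confined path\<close>

text \<open>Up to time \<open>\<surd>n\<close> all biases are of order \<open>\<surd>n\<close>, so \<open>balanced\<close> applies on the window from \<open>\<surd>n\<close> to
  \<open>n\<close> with a threshold of order \<open>\<surd>n + h n\<close>, which is negligible compared to \<open>n\<close>.\<close>

lemma local_time_asymptotics:
  fixes h :: "nat \<Rightarrow> real"
  assumes k: "1 \<le> k" and small: "real (k + 1) * \<omega> < 2 * pi"
    and h: "mono h" "\<And>n. 0 \<le> h n" "(\<lambda>n. h n / real n) \<longlonglongrightarrow> 0"
    and step: "\<And>n. N \<le> n \<Longrightarrow> \<bar>p (Suc n) - p n\<bar> = 1"
    and conf: "\<And>n. N \<le> n \<Longrightarrow> a \<le> p n \<and> p n \<le> a + int k"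
    and right: "\<And>n. N \<le> n \<Longrightarrow> Delta \<alpha> p n (p n) > h n \<Longrightarrow> p (Suc n) = p n + 1"
    and left: "\<And>n. N \<le> n \<Longrightarrow> Delta \<alpha> p n (p n) < - h n \<Longrightarrow> p (Suc n) = p n - 1"
    and i: "1 \<le> i" "i \<le> k"
  shows "(\<lambda>n. real (local_time p n (a + int i)) / real n) \<longlonglongrightarrow> weight k i"
proof -
  obtain B where B: "B \<ge> 1" "\<And>S p a s T n i. 1 \<le> S \<Longrightarrow> guided \<alpha> S p a (a + int k) s T \<Longrightarrow> flat \<alpha> p a k s S \<Longrightarrow>
     s \<le> n \<Longrightarrow> n \<le> T \<Longrightarrow> i \<le> k + 1 \<Longrightarrow>
     \<bar>crossings p s n (a + int i) - (real n - real s) * weight k i\<bar> \<le> B * S"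
    using balanced[OF k small] stable_and_sweeping[OF k small] by blast
  define w where "w = weight k i"
  have w: "w \<ge> 0" using weight_pos[OF i small] by (simp add: w_def)
  define D where "D = 2 + 2 * \<alpha>"
  have D: "D \<ge> 0" using alpha_pos by (simp add: D_def)
  let ?l = "\<lambda>n. real (local_time p n (a + int i))"
  define err where "err n = B * (1 + h n + D * sqrt (real n)) + (1 + w) * sqrt (real n)" for n
  have main: "\<bar>?l n / real n - w\<bar> \<le> err n / real n" if n: "(N + 1)\<^sup>2 \<le> n" for n
  proof -
    define s where "s = nat \<lfloor>sqrt (real n)\<rfloor>"
    define S where "S = 1 + h n + D * real s"
    have sq: "real N + 1 \<le> sqrt (real n)"
      using n by (intro real_le_rsqrt) (metis of_nat_le_iff of_nat_power of_nat_add of_nat_1)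
    have s1: "real s \<le> sqrt (real n)" by (simp add: s_def)
    have s2: "N \<le> s" using sq by (simp add: s_def le_nat_iff le_floor_iff)
    have n0: "1 \<le> n" using n by (simp add: power2_eq_square)
    have "sqrt (real n) \<le> real n" using n0 by (intro real_le_lsqrt) (auto simp: power2_eq_square)
    then have s3: "s \<le> n" using s1 by linarith
    have S: "1 \<le> S" "h n \<le> S" using h(2)[of n] D by (simp_all add: S_def)
    have g: "guided \<alpha> S p a (a + int k) s n"
      unfolding guided_def
    proof (intro conjI ballI impI)
      fix m assume m: "m \<in> {s..<n}"
      then have "h m \<le> S" using monoD[OF h(1), of m n] S by simp
      then show "p (Suc m) = p m + 1" if "S < Delta \<alpha> p m (p m)"
        using right[of m] m s2 that by auto
      show "p (Suc m) = p m - 1" if "Delta \<alpha> p m (p m) < - S"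
        using left[of m] m s2 that \<open>h m \<le> S\<close> by auto
    qed (use s2 conf step in auto)
    have fl: "flat \<alpha> p a k s S" unfolding flat_def
    proof (intro allI impI)
      fix j show "\<bar>Delta \<alpha> p s (a + int j)\<bar> \<le> S"
        using Delta_bound[of \<alpha> p s "a + int j"] alpha_pos h(2)[of n] by (simp add: S_def D_def)
    qed
    have b1: "\<bar>crossings p s n (a + int i) - (real n - real s) * w\<bar> \<le> B * S"
      using B(2)[OF S(1) g fl s3, of i] i by (simp add: w_def)
    have b2: "0 \<le> ?l s" "?l s \<le> real s"
      using crossings_bounds[of 0 s p "a + int i"] by (simp_all add: crossings_def)
    have "\<bar>?l n - real n * w\<bar> \<le> B * S + real s + real s * w"
      using b1 b2 mult_nonneg_nonneg[of "real s" w] w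
      unfolding crossings_def left_diff_distrib by linarith
    also have "\<dots> \<le> err n"
    proof -
      have "B * S \<le> B * (1 + h n + D * sqrt (real n))"
        using B(1) D s1 by (auto simp: S_def intro!: mult_left_mono)
      moreover have "(1 + w) * real s \<le> (1 + w) * sqrt (real n)" using w s1 by (intro mult_left_mono) auto
      ultimately show ?thesis by (simp add: err_def algebra_simps)
    qed
    finally have "\<bar>?l n - real n * w\<bar> / real n \<le> err n / real n" by (intro divide_right_mono) auto
    moreover have "?l n / real n - w = (?l n - real n * w) / real n"
      using n0 by (simp add: diff_divide_distrib)
    ultimately show ?thesis by (simp add: abs_divide)
  qed
  have "(\<lambda>n. B * (h n / real n) + (B * ((1 + D * sqrt (real n)) / real n) + (1 + w) * (sqrt (real n) / real n)))
     \<longlonglongrightarrow> B * 0 + (B * 0 + (1 + w) * 0)"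
    by (intro tendsto_add tendsto_mult tendsto_const h(3)) real_asymp+
  moreover have "B * (h n / real n) + (B * ((1 + D * sqrt (real n)) / real n) + (1 + w) * (sqrt (real n) / real n))
     = err n / real n" for n
    by (simp add: err_def add_divide_distrib algebra_simps)
  ultimately have lim: "(\<lambda>n. err n / real n) \<longlonglongrightarrow> 0" by simp
  have "(\<lambda>n. ?l n / real n - w) \<longlonglongrightarrow> 0"
    by (rule Lim_null_comparison[OF _ lim]) (auto simp: eventually_sequentially intro!: exI[of _ "(N + 1)\<^sup>2"] main)
  then show ?thesis by (simp add: w_def LIM_zero_iff)
qed

end

text \<open>To leave the interval a nearest neighbour path has to visit one of the two adjacent sites, and these are
  visited only finitely often.\<close>

lemma eventually_confined:
  fixes p :: "nat \<Rightarrow> int"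
  assumes step: "\<And>n. \<bar>p (Suc n) - p n\<bar> = 1"
    and vis: "visited_infinitely_often p = {a..b}" and "a \<le> b"
  obtains N where "\<And>n. N \<le> n \<Longrightarrow> a \<le> p n \<and> p n \<le> b"
proof -
  have fin: "finite {n. p n = y}" if "y < a \<or> b < y" for y
  proof -
    have "y \<notin> visited_infinitely_often p" using vis that by auto
    then show ?thesis by (simp add: visited_infinitely_often_def)
  qed
  have "finite ({n. p n = a - 1} \<union> {n. p n = b + 1})" 
    by (intro finite_UnI fin) auto
  then obtain N0 where "\<forall>n\<in>{n. p n = a - 1} \<union> {n. p n = b + 1}. n < N0"
    unfolding finite_nat_set_iff_bounded ..
  then have N0: "p n \<noteq> a - 1 \<and> p n \<noteq> b + 1" if "N0 \<le> n" for n
    using that by (auto dest!: bspec[of _ _ n])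
  have "a \<in> visited_infinitely_often p" using vis assms(3) by simp
  then have "infinite {n. p n = a}" by (simp add: visited_infinitely_often_def)
  then obtain N where N: "N0 \<le> N" "p N = a"
    unfolding infinite_nat_iff_unbounded_le by auto
  have "a \<le> p n \<and> p n \<le> b" if "N \<le> n" for n
    using that
  proof (induction n rule: dec_induct)
    case base
    then show ?case using N assms(3) by simp
  next
    case (step n)
    have "p (Suc n) \<noteq> a - 1" "p (Suc n) \<noteq> b + 1" using N0[of "Suc n"] N step by auto
    then show ?case using step assms(1)[of n] by auto
  qed
  then show thesis using that by blast
qed

section \<open>The random walk obeys the drift rule\<close>

lemma local_time_cong:
  assumes "\<And>i. i \<le> n \<Longrightarrow> p i = q i"
  shows "local_time p n j = local_time q n j"
proof -
  have "{m. 1 \<le> m \<and> m \<le> n \<and> {p (m - 1), p m} = {j - 1, j}} = {m. 1 \<le> m \<and> m \<le> n \<and> {q (m - 1), q m} = {j - 1, j}}"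
    using assms by (intro Collect_cong conj_cong refl) simp
  then show ?thesis by (simp add: local_time_def)
qed

lemma Delta_cong:
  assumes "\<And>i. i \<le> n \<Longrightarrow> p i = q i"
  shows "Delta \<alpha> p n (p n) = Delta \<alpha> q n (q n)"
  using local_time_cong[OF assms] assms[of n] by (simp add: Delta_def)

lemma two_point_prob_le:
  fixes x c :: real
  assumes "c \<le> x"
  shows "exp (- x) / (exp x + exp (- x)) \<le> exp (- 2 * c)"
proof -
  have "exp (- x) / (exp x + exp (- x)) \<le> exp (- x) / exp x"
    by (intro divide_left_mono mult_pos_pos add_pos_pos) auto
  also have "\<dots> = exp (- 2 * x)" by (simp flip: exp_diff)
  also have "\<dots> \<le> exp (- 2 * c)" using assms by simp
  finally show ?thesis .
qed

context self_interacting_walk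
begin

text \<open>There are only countably many values of \<open>(X 0, \<dots>, X n)\<close>, so every event that depends on them
  alone is a countable union of cylinders.\<close>

lemma past_event_measurable:
  assumes "\<And>p q. (\<And>i. i \<le> n \<Longrightarrow> p i = q i) \<Longrightarrow> Q p \<Longrightarrow> Q q"
  shows "{\<xi> \<in> space M. Q (\<lambda>i. X i \<xi>)} \<in> sets (path_filtration M X n)"
proof -
  let ?F = "path_filtration M X n"
  have sp: "space ?F = space M" by (simp add: path_filtration_def space_measure_of_conv)
  have cyl: "X i -` A \<inter> space M \<in> sets ?F" if "i \<le> n" for i A
  proof -
    have "{X i -` A \<inter> space M | i A. i \<le> n} \<subseteq> Pow (space M)" by blast
    then show ?thesis using that
      by (auto simp: path_filtration_def sets_measure_of intro!: sigma_sets.Basic)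
  qed
  define pth where "pth xs = (\<lambda>i. if i < length xs then xs ! i else 0)" for xs :: "int list"
  define L where "L = {xs. length xs = Suc n \<and> Q (pth xs)}"
  have "{\<xi> \<in> space M. Q (\<lambda>i. X i \<xi>)} = (\<Union>xs\<in>L. \<Inter>i\<in>{..n}. X i -` {xs ! i} \<inter> space M)"
  proof (intro set_eqI iffI)
    fix \<xi> assume "\<xi> \<in> {\<xi> \<in> space M. Q (\<lambda>i. X i \<xi>)}"
    then have x: "\<xi> \<in> space M" "Q (\<lambda>i. X i \<xi>)" by auto
    let ?xs = "map (\<lambda>i. X i \<xi>) [0..<Suc n]"
    have "Q (pth ?xs)"
      by (rule assms[OF _ x(2)]) (simp add: pth_def less_Suc_eq_le del: upt_Suc)
    then have "?xs \<in> L" by (simp add: L_def)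
    moreover have "\<xi> \<in> (\<Inter>i\<in>{..n}. X i -` {?xs ! i} \<inter> space M)"
      using x(1) by (auto simp: less_Suc_eq_le simp del: upt_Suc)
    ultimately show "\<xi> \<in> (\<Union>xs\<in>L. \<Inter>i\<in>{..n}. X i -` {xs ! i} \<inter> space M)" by blast
  next
    fix \<xi> assume "\<xi> \<in> (\<Union>xs\<in>L. \<Inter>i\<in>{..n}. X i -` {xs ! i} \<inter> space M)"
    then obtain xs where xs: "length xs = Suc n" "Q (pth xs)" and *: "\<And>i. i \<le> n \<Longrightarrow> X i \<xi> = xs ! i \<and> \<xi> \<in> space M"
      by (auto simp: L_def)
    have "Q (\<lambda>i. X i \<xi>)"
      by (rule assms[OF _ xs(2)]) (use * xs(1) in \<open>simp add: pth_def\<close>)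
    then show "\<xi> \<in> {\<xi> \<in> space M. Q (\<lambda>i. X i \<xi>)}" using *[of 0] by simp
  qed
  also have "\<dots> \<in> sets ?F"
  proof (rule sets.countable_UN'')
    show "countable L" by (rule countableI_type)
    show "(\<Inter>i\<in>{..n}. X i -` {xs ! i} \<inter> space M) \<in> sets ?F" for xs
      using cyl by (intro sets.finite_INT) auto
  qed
  finally show ?thesis .
qed

lemma X_event_measurable:
  "{\<eta> \<in> space M. X (Suc n) \<eta> = X n \<eta> + c} \<in> sets M"
proof -
  have "{\<eta> \<in> space M. X (Suc n) \<eta> = X n \<eta> + c} \<in> sets (path_filtration M X (Suc n))"
    by (rule past_event_measurable[where Q = "\<lambda>p. p (Suc n) = p n + c"]) simp
  then show ?thesis
    using subalgebra_path_filtration[of "Suc n"] by (auto simp: subalgebra_def)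
qed

text \<open>The conditional probability may be integrated over the event \<open>Q\<close>, which belongs to the past.\<close>

lemma unlikely_step:
  fixes c \<epsilon> :: real and d :: int
  assumes ce: "AE \<xi> in M. real_cond_exp M (path_filtration M X n)
        (indicator {\<eta> \<in> space M. X (Suc n) \<eta> = X n \<eta> + d}) \<xi> = f (\<lambda>k. X k \<xi>)"
    and Q: "\<And>p q. (\<And>i. i \<le> n \<Longrightarrow> p i = q i) \<Longrightarrow> Q p \<Longrightarrow> Q q"
    and small: "\<And>p. Q p \<Longrightarrow> f p \<le> \<epsilon>" and "0 \<le> \<epsilon>"
  shows "prob {\<xi> \<in> space M. Q (\<lambda>k. X k \<xi>) \<and> X (Suc n) \<xi> = X n \<xi> + d} \<le> \<epsilon>"
proof -
  let ?F = "path_filtration M X n"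
  let ?A = "{\<xi> \<in> space M. Q (\<lambda>k. X k \<xi>)}"
  let ?B = "{\<eta> \<in> space M. X (Suc n) \<eta> = X n \<eta> + d}"
  interpret F: finite_measure_subalgebra M ?F
    by unfold_locales (rule subalgebra_path_filtration)
  have AF: "?A \<in> sets ?F" by (rule past_event_measurable[OF Q])
  then have A: "?A \<in> sets M" using subalgebra_path_filtration[of n] by (auto simp: subalgebra_def)
  have B: "?B \<in> sets M" by (rule X_event_measurable)
  have intB: "integrable M (indicator ?B :: _ \<Rightarrow> real)"
    using B by (rule integrable_real_indicator) (simp add: less_top[symmetric])
  have "prob (?A \<inter> ?B) = (\<integral>\<xi>. indicator ?A \<xi> * indicator ?B \<xi> \<partial>M)"
    using A B by (simp flip: indicator_inter_arith)
  also have "\<dots> = (\<integral>\<xi>. indicator ?A \<xi> * real_cond_exp M ?F (indicator ?B) \<xi> \<partial>M)"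
    using F.real_cond_exp_intA[OF intB AF] by (simp add: set_lebesgue_integral_def)
  also have "\<dots> \<le> (\<integral>\<xi>. \<epsilon> \<partial>M)"
  proof (rule integral_mono_AE)
    show "integrable M (\<lambda>\<xi>. indicator ?A \<xi> * real_cond_exp M ?F (indicator ?B) \<xi>)"
      using integrable_mult_indicator[OF A F.real_cond_exp_int(1)[OF intB]] by simp
    show "AE \<xi> in M. indicator ?A \<xi> * real_cond_exp M ?F (indicator ?B) \<xi> \<le> \<epsilon>"
      using ce by eventually_elim (use small \<open>0 \<le> \<epsilon>\<close> in \<open>auto simp: indicator_def\<close>)
  qed simp
  also have "\<dots> = \<epsilon>" by (simp add: prob_space)
  also have "?A \<inter> ?B = {\<xi> \<in> space M. Q (\<lambda>k. X k \<xi>) \<and> X (Suc n) \<xi> = X n \<xi> + d}" by auto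
  finally show ?thesis .
qed

lemma eventually_no_unlikely_step:
  fixes \<epsilon> :: "nat \<Rightarrow> real" and d :: int
  assumes ce: "\<And>n. AE \<xi> in M. real_cond_exp M (path_filtration M X n)
        (indicator {\<eta> \<in> space M. X (Suc n) \<eta> = X n \<eta> + d}) \<xi> = f n (\<lambda>k. X k \<xi>)"
    and Q: "\<And>n p q. (\<And>i. i \<le> n \<Longrightarrow> p i = q i) \<Longrightarrow> Q n p \<Longrightarrow> Q n q"
    and small: "\<And>n p. Q n p \<Longrightarrow> f n p \<le> \<epsilon> n" and \<epsilon>: "\<And>n. 0 \<le> \<epsilon> n" "summable \<epsilon>"
  shows "AE \<xi> in M. \<forall>\<^sub>F n in sequentially. Q n (\<lambda>k. X k \<xi>) \<longrightarrow> X (Suc n) \<xi> \<noteq> X n \<xi> + d"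
proof -
  define W where "W n = {\<xi> \<in> space M. Q n (\<lambda>k. X k \<xi>) \<and> X (Suc n) \<xi> = X n \<xi> + d}" for n
  have prob: "prob (W n) \<le> \<epsilon> n" for n
    unfolding W_def
    by (rule unlikely_step[where Q = "Q n" and f = "f n", OF ce _ small \<epsilon>(1)]) (rule Q)
  have "W n \<in> sets M" for n
  proof -
    have "W n \<in> sets (path_filtration M X (Suc n))"
      unfolding W_def
    proof (rule past_event_measurable[where Q = "\<lambda>p. Q n p \<and> p (Suc n) = p n + d"])
      fix p q :: "nat \<Rightarrow> int"
      assume eq: "\<And>i. i \<le> Suc n \<Longrightarrow> p i = q i" and p: "Q n p \<and> p (Suc n) = p n + d"
      then show "Q n q \<and> q (Suc n) = q n + d"
        using Q[of n p q] eq[of n] eq[of "Suc n"] by auto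
    qed
    then show ?thesis
      using subalgebra_path_filtration[of "Suc n"] by (auto simp: subalgebra_def)
  qed
  moreover have "summable (\<lambda>n. prob (W n))"
    by (rule summable_comparison_test'[OF \<epsilon>(2)]) (use prob in auto)
  ultimately have "AE \<xi> in M. \<forall>\<^sub>F n in sequentially. \<xi> \<in> space M - W n"
    by (intro borel_cantelli_AE1) (auto simp: less_top[symmetric])
  then show ?thesis
  proof eventually_elim
    case (elim \<xi>)
    then show ?case by eventually_elim (simp add: W_def)
  qed
qed

text \<open>With a bias beyond \<open>ln (n + 1) / \<beta>\<close>, the step against the bias has conditional probability at most
  \<open>1 / (n + 1)\<^sup>2\<close>, which is summable.\<close>

lemma eventually_repelled:
  assumes "\<beta> > 0"
  shows "AE \<xi> in M. \<forall>\<^sub>F n in sequentially.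
     (Delta \<alpha> (\<lambda>k. X k \<xi>) n (X n \<xi>) > ln (real (Suc n)) / \<beta> \<longrightarrow> X (Suc n) \<xi> \<noteq> X n \<xi> - 1) \<and>
     (Delta \<alpha> (\<lambda>k. X k \<xi>) n (X n \<xi>) < - (ln (real (Suc n)) / \<beta>) \<longrightarrow> X (Suc n) \<xi> \<noteq> X n \<xi> + 1)"
proof -
  let ?D = "\<lambda>n p. Delta \<alpha> p n (p n)"
  let ?h = "\<lambda>n. ln (real (Suc n)) / \<beta>"
  let ?\<epsilon> = "\<lambda>n. 1 / (real (Suc n))\<^sup>2"
  have e: "exp (- 2 * ln (real (Suc n))) = ?\<epsilon> n" for n
    by (simp add: exp_minus exp_double inverse_eq_divide)
  have \<epsilon>: "0 \<le> ?\<epsilon> n" for n by simp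
  have summ: "summable ?\<epsilon>"
    using inverse_power_summable[of 2, where 'a = real]
    by (subst summable_Suc_iff[of "\<lambda>n. 1 / (real n)\<^sup>2"]) (simp add: inverse_eq_divide power_one_over)
  have D: "?D n p = ?D n q" if "\<And>i. i \<le> n \<Longrightarrow> p i = q i" for n p q
    by (rule Delta_cong) (rule that)
  have "AE \<xi> in M. \<forall>\<^sub>F n in sequentially. ?h n < ?D n (\<lambda>k. X k \<xi>) \<longrightarrow> X (Suc n) \<xi> \<noteq> X n \<xi> + (- 1)"
  proof (rule eventually_no_unlikely_step[where Q = "\<lambda>n p. ?h n < ?D n p" and \<epsilon> = ?\<epsilon>
        and f = "\<lambda>n p. exp (- \<beta> * ?D n p) / (exp (\<beta> * ?D n p) + exp (- \<beta> * ?D n p))"])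
    show "AE \<xi> in M. real_cond_exp M (path_filtration M X n)
        (indicator {\<eta> \<in> space M. X (Suc n) \<eta> = X n \<eta> + (- 1)}) \<xi> =
      exp (- \<beta> * ?D n (\<lambda>k. X k \<xi>)) / (exp (\<beta> * ?D n (\<lambda>k. X k \<xi>)) + exp (- \<beta> * ?D n (\<lambda>k. X k \<xi>)))" for n
      using step_left[of n] by (simp add: Let_def)
    show "exp (- \<beta> * ?D n p) / (exp (\<beta> * ?D n p) + exp (- \<beta> * ?D n p)) \<le> ?\<epsilon> n" if "?h n < ?D n p" for n p
      using two_point_prob_le[of "ln (real (Suc n))" "\<beta> * ?D n p"] that assms
      unfolding e by (simp add: field_simps)
    show "?h n < ?D n q" if "\<And>i. i \<le> n \<Longrightarrow> p i = q i" "?h n < ?D n p" for n p q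
      using that(2) D[of n p q, OF that(1)] by simp
  qed (rule \<epsilon> summ)+
  moreover have "AE \<xi> in M. \<forall>\<^sub>F n in sequentially. ?D n (\<lambda>k. X k \<xi>) < - ?h n \<longrightarrow> X (Suc n) \<xi> \<noteq> X n \<xi> + 1"
  proof (rule eventually_no_unlikely_step[where Q = "\<lambda>n p. ?D n p < - ?h n" and \<epsilon> = ?\<epsilon>
        and f = "\<lambda>n p. exp (\<beta> * ?D n p) / (exp (\<beta> * ?D n p) + exp (- \<beta> * ?D n p))"])
    show "AE \<xi> in M. real_cond_exp M (path_filtration M X n)
        (indicator {\<eta> \<in> space M. X (Suc n) \<eta> = X n \<eta> + 1}) \<xi> =
      exp (\<beta> * ?D n (\<lambda>k. X k \<xi>)) / (exp (\<beta> * ?D n (\<lambda>k. X k \<xi>)) + exp (- \<beta> * ?D n (\<lambda>k. X k \<xi>)))" for n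
      using step_right[of n] by (simp add: Let_def)
    show "exp (\<beta> * ?D n p) / (exp (\<beta> * ?D n p) + exp (- \<beta> * ?D n p)) \<le> ?\<epsilon> n" if "?D n p < - ?h n" for n p
      using two_point_prob_le[of "ln (real (Suc n))" "- (\<beta> * ?D n p)"] that assms
      unfolding e by (simp add: field_simps)
    show "?D n q < - ?h n" if "\<And>i. i \<le> n \<Longrightarrow> p i = q i" "?D n p < - ?h n" for n p q
      using that(2) D[of n p q, OF that(1)] by simp
  qed (rule \<epsilon> summ)+
  ultimately show ?thesis
  proof eventually_elim
    case (elim \<xi>)
    then show ?case by eventually_elim auto
  qed
qed

end

section \<open>The limit theorem\<close>

text \<open>The threshold \<open>\<alpha>\<^sub>L\<close> is the value of \<open>\<alpha>\<close> for which \<open>\<omega> = 2 \<pi> / (L + 2)\<close>; for \<open>L = 1\<close>, where it is infinite,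
  the bound \<open>cos \<omega> > - 1 / 2\<close> holds because \<open>\<alpha>\<close> is positive.\<close>

lemma omega_small:
  fixes \<alpha> \<omega> :: real and L :: nat
  assumes "L \<ge> 1" and "0 < \<alpha>" and "ereal \<alpha> < threshold L"
    and "0 < \<omega>" and "\<omega> < pi" and "cos \<omega> = (1 - \<alpha>) / (2 * \<alpha>)"
  shows "real (L + 2) * \<omega> < 2 * pi"
proof -
  define \<theta> where "\<theta> = 2 * pi / real (L + 2)"
  have th: "0 < \<theta>" "\<theta> < pi" using assms(1) by (simp_all add: \<theta>_def field_simps)
  have co: "cos \<omega> = (1 / \<alpha> - 1) / 2" using assms(2,6) by (simp add: field_simps)
  have "cos \<theta> < cos \<omega>"
  proof (cases "L = 1")
    case True
    have "cos \<theta> = - 1 / 2" using True cos_120 by (simp add: \<theta>_def)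
    moreover have "1 / \<alpha> > 0" using assms(2) by simp
    ultimately show ?thesis unfolding co by simp
  next
    case False
    then have "\<theta> \<le> pi / 2" using assms(1) by (simp add: \<theta>_def field_simps)
    then have "0 \<le> cos \<theta>" using th by (intro cos_ge_zero) auto
    moreover have "\<alpha> < 1 / (1 + 2 * cos \<theta>)" using assms(3) False by (simp add: threshold_def \<theta>_def)
    ultimately have "1 + 2 * cos \<theta> < 1 / \<alpha>" using assms(2) by (simp add: field_simps)
    then show ?thesis unfolding co by simp
  qed
  then have "\<omega> < \<theta>"
    using th assms(4,5) cos_monotone_0_pi_le[of \<theta> \<omega>] by linarith
  then show ?thesis by (simp add: \<theta>_def field_simps)
qed

lemma threshold_pos:
  assumes "L \<ge> 1" "threshold (L + 1) < ereal \<alpha>"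
  shows "0 < \<alpha>"
proof -
  have "2 * pi / real (L + 3) \<le> pi / 2" using assms(1) by (simp add: field_simps)
  moreover have "0 \<le> 2 * pi / real (L + 3)" by simp
  ultimately have "0 \<le> cos (2 * pi / real (L + 3))"
    by (intro cos_ge_zero) (use pi_gt_zero in linarith)+
  moreover have "1 / (1 + 2 * cos (2 * pi / real (L + 3))) < \<alpha>"
    using assms by (simp add: threshold_def numeral_eq_Suc)
  moreover have "0 < 1 / (1 + 2 * c)" if "0 \<le> c" for c :: real using that by simp
  ultimately show ?thesis by (meson less_trans)
qed

theorem mainTheorem2:
  fixes M :: "'a measure" and X :: "nat \<Rightarrow> 'a \<Rightarrow> int"
    and \<alpha> \<beta> \<omega> \<phi> Z :: real and L :: nat and u :: "nat \<Rightarrow> real"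
  assumes "\<beta> > 0"
    and "L \<ge> 1"
    and "threshold (L + 1) < ereal \<alpha>" and "ereal \<alpha> < threshold L"
    and "self_interacting_walk M \<alpha> \<beta> X"
    and "0 < \<omega>" and "\<omega> < pi" and "cos \<omega> = (1 - \<alpha>) / (2 * \<alpha>)"
    and "\<phi> = (2 * pi - real (L + 2) * \<omega>) / 2"
    and "\<And>j. j \<in> {1..L + 1} \<Longrightarrow> u j = (cos \<phi> - cos (\<omega> * real j + \<phi>)) / Z"
    and "(\<Sum>j = 1..L + 1. u j) = 1"
  shows "\<forall>x :: int. AE \<xi> in M.
    visited_infinitely_often (\<lambda>k. X k \<xi>) = {x..x + int L + 1} \<longrightarrow>
    (\<forall>j \<in> {1..L + 1}.
      (\<lambda>n. real (local_time (\<lambda>k. X k \<xi>) n (x + int j)) / real n) \<longlonglongrightarrow> u j)"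
proof
  fix x :: int
  interpret self_interacting_walk M \<alpha> \<beta> X by fact
  have \<alpha>: "0 < \<alpha>" using threshold_pos assms(2,3) .
  interpret walk_params \<alpha> \<omega> by unfold_locales (use \<alpha> assms in auto)
  have small: "real (L + 1 + 1) * \<omega> < 2 * pi" using omega_small[OF assms(2) \<alpha> assms(4,6,7,8)] by simp
  have u: "u j = weight (L + 1) j" if "j \<in> {1..L + 1}" for j
  proof -
    have prof: "cos \<phi> - cos (\<omega> * real j + \<phi>) = profile (L + 1) j" for j
    proof -
      have "\<phi> = pi - \<omega> * real (L + 1 + 1) / 2" using assms(9) by (simp add: field_simps)
      moreover have "cos (pi - c) - cos (\<omega> * real j + (pi - c)) = cos (\<omega> * real j - c) - cos c" for c
        using cos_minus_pi[of "\<omega> * real j - c + 2 * pi"] 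
        by (simp add: cos_diff cos_add algebra_simps)
      ultimately show ?thesis by (simp only: profile_def)
    qed
    have "(\<Sum>j = 1..L + 1. profile (L + 1) j / Z) = 1"
      using assms(11) assms(10) by (simp only: prof cong: sum.cong)
    then have "Z = (\<Sum>j = 1..L + 1. profile (L + 1) j)"
      unfolding sum_divide_distrib[symmetric] by (simp only: divide_eq_1_iff)
    then show ?thesis using assms(10)[OF that] by (simp only: prof weight_def)
  qed
  define h where "h n = ln (real (Suc n)) / \<beta>" for n
  have h: "mono h" "\<And>n. 0 \<le> h n"
    using assms(1) by (auto simp: h_def mono_def divide_right_mono)
  have h0: "(\<lambda>n. h n / real n) \<longlonglongrightarrow> 0"
    unfolding h_def using assms(1) by real_asymp
  show "AE \<xi> in M. visited_infinitely_often (\<lambda>k. X k \<xi>) = {x..x + int L + 1} \<longrightarrow>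
    (\<forall>j \<in> {1..L + 1}.
      (\<lambda>n. real (local_time (\<lambda>k. X k \<xi>) n (x + int j)) / real n) \<longlonglongrightarrow> u j)"
    using nearest_neighbour eventually_repelled[OF assms(1)]
  proof (eventually_elim, intro impI ballI)
    fix \<xi> j
    let ?p = "\<lambda>k. X k \<xi>"
    assume nn: "\<forall>n. \<bar>X (Suc n) \<xi> - X n \<xi>\<bar> = 1"
      and ev: "\<forall>\<^sub>F n in sequentially.
       (Delta \<alpha> ?p n (X n \<xi>) > ln (real (Suc n)) / \<beta> \<longrightarrow> X (Suc n) \<xi> \<noteq> X n \<xi> - 1) \<and>
       (Delta \<alpha> ?p n (X n \<xi>) < - (ln (real (Suc n)) / \<beta>) \<longrightarrow> X (Suc n) \<xi> \<noteq> X n \<xi> + 1)"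
      and vis: "visited_infinitely_often ?p = {x..x + int L + 1}" and j: "j \<in> {1..L + 1}"
    obtain N1 where N1: "\<And>n. N1 \<le> n \<Longrightarrow> x \<le> ?p n \<and> ?p n \<le> x + int L + 1"
      using eventually_confined[of ?p x "x + int L + 1"] nn vis by auto
    obtain N2 where N2: "\<And>n. N2 \<le> n \<Longrightarrow>
       (Delta \<alpha> ?p n (X n \<xi>) > h n \<longrightarrow> X (Suc n) \<xi> \<noteq> X n \<xi> - 1) \<and>
       (Delta \<alpha> ?p n (X n \<xi>) < - h n \<longrightarrow> X (Suc n) \<xi> \<noteq> X n \<xi> + 1)"
      using ev unfolding eventually_sequentially h_def by blast
    have pm: "X (Suc n) \<xi> = X n \<xi> + 1 \<or> X (Suc n) \<xi> = X n \<xi> - 1" for n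
      using nn[rule_format, of n] by linarith
    show "(\<lambda>n. real (local_time ?p n (x + int j)) / real n) \<longlonglongrightarrow> u j"
      unfolding u[OF j]
    proof (rule local_time_asymptotics[where N = "max N1 N2" and h = h])
      show "x \<le> X n \<xi> \<and> X n \<xi> \<le> x + int (L + 1)" if "max N1 N2 \<le> n" for n
        using N1[of n] that by simp
      show "X (Suc n) \<xi> = X n \<xi> + 1" if "max N1 N2 \<le> n" "h n < Delta \<alpha> ?p n (X n \<xi>)" for n
        using N2[of n] pm[of n] that by auto
      show "X (Suc n) \<xi> = X n \<xi> - 1" if "max N1 N2 \<le> n" "Delta \<alpha> ?p n (X n \<xi>) < - h n" for n
        using N2[of n] pm[of n] that by auto
    qed (use small h h0 nn j in auto)
  qed
qed

end
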